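(* Let $J$ be the monic Jacobi matrix associated with a nonrational function $F\in\mathbf N_{-\infty}$, let $s_{-1}\in\mathbb R$, and let $J=\mathfrak U\mathfrak L$ be the block $UL$-factorization of $J$ corresponding to the parameter $s_{-1}$. Then $\mathfrak J=\mathfrak L\mathfrak U$ is the monic generalized Jacobi matrix associated with the function $\frac{F(\lambda)}{\lambda}-\frac{s_{-1}}{\lambda}\in\mathbf D^+_{-\infty}$.
   Context: $\lambda\widehat\to\infty$ means that $\lambda\to\infty$ inside a sector $\varepsilon<\arg\lambda<\pi-\varepsilon$, $\varepsilon>0$. $\mathbf N$ is the class of Nevanlinna functions (analytic in $\mathbb C_+$, mapping $\mathbb C_+$ into $\mathbb C_+$). $\mathbf N_{-\infty}$ is the set of $F\in\mathbf N$ for which there are real $s_0,s_1,\dots$ with $F(\lambda)=-\frac{s_0}{\lambda}-\dots-\frac{s_{2n}}{\lambda^{2n+1}}+o(\lambda^{-2n-1})$, $\lambda\widehat\to\infty$, for every $n\in\mathbb Z_+$ (written $F(\lambda)\sim-\sum_j s_j\lambda^{-j-1}$); equivalently $F(\lambda)=\int_{\mathbb R}\frac{d\sigma(t)}{t-\lambda}$ with a finite measure $\sigma$ with moments $s_j=\int t^jd\sigma(t)$. The polynomials of the first kind $P_j$ are the monic orthogonal polynomials of $\sigma/s_0$: $\lambda P_j=P_{j+1}+b_jP_j+c_{j-1}P_{j-1}$, $P_{-1}=0$, $P_0=1$, $b_j\in\mathbb R$, $c_j>0$; those of the second kind are $Q_j(\lambda)=\int\frac{P_j(\lambda)-P_j(t)}{\lambda-t}d\sigma(t)$.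 The monic Jacobi matrix $J$ associated with $F$ is the semi-infinite tridiagonal matrix with $J_{j,j}=b_j$, $J_{j,j+1}=1$, $J_{j+1,j}=c_j$. $\mathbf D^+_{-\infty}$: functions $\mathfrak F$ meromorphic in $\mathbb C_+$ with $\mathfrak F(\lambda)\sim-\sum_{j\ge0}\mathfrak s_j\lambda^{-j-1}$, $\mathfrak s_j\in\mathbb R$, and $\lambda\mathfrak F(\lambda)+\mathfrak s_0\in\mathbf N_{-\infty}$. $\mathbf D^-_{-\infty}$: functions $\mathfrak F$ meromorphic in $\mathbb C_+$ such that for some $\mathfrak s_{-1}\in\mathbb R\setminus\{0\}$ one has $-\frac{\mathfrak s_{-1}}{\lambda}+\frac{\mathfrak F(\lambda)}{\lambda}\in\mathbf N_{-\infty}$. Normal indices of a real sequence $\{\mathfrak s_j\}_{j\ge0}$: the integers $n\ge1$ with $\det(\mathfrak s_{i+k})_{i,k=0}^{n-1}\neq0$, listed increasingly $\mathfrak n_1<\mathfrak n_2<\cdots$; $\mathfrak n_0=0$, $\mathfrak k_j=\mathfrak n_{j+1}-\mathfrak n_j$ (always $\mathfrak k_j\in\{1,2\}$ here). Generalized Jacobi matrix: let $\mathfrak F\in\mathbf D^\pm_{-\infty}$ be nonrational with $\mathfrak F\sim-\sum\mathfrak s_j\lambda^{-j-1}$. It is normalized if its first nonzero coefficient $\mathfrak s_{\mathfrak n_1-1}$ has modulus $1$. For normalized $\mathfrak F$ put $\mathfrak F_0=\mathfrak F$ and define recursively $-1/\mathfrak F_j(\lambda)=\epsilon_j\mathfrak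 p_j(\lambda)+\mathfrak b_j^2\mathfrak F_{j+1}(\lambda)$, where $\epsilon_j=\pm1$ is the first nonzero asymptotic coefficient of $\mathfrak F_j$, $\mathfrak p_j$ is the monic polynomial (of degree $\mathfrak k_j$) for which $-1/\mathfrak F_j-\epsilon_j\mathfrak p_j=o(1)$ as $\lambda\widehat\to\infty$, and $\mathfrak b_j>0$ is such that $\mathfrak F_{j+1}$ is normalized. Put $\mathfrak c_j=\epsilon_j\epsilon_{j+1}\mathfrak b_j^2$; write $\mathfrak p_j(\lambda)=\lambda+\mathfrak p_0^{(j)}$ if $\mathfrak k_j=1$ and $\mathfrak p_j(\lambda)=\lambda^2+\mathfrak p_1^{(j)}\lambda+\mathfrak p_0^{(j)}$ if $\mathfrak k_j=2$. The monic generalized Jacobi matrix associated with $\mathfrak F$ is the block tridiagonal matrix with diagonal blocks $\mathfrak B_j=-\mathfrak p_0^{(j)}$ if $\mathfrak k_j=1$, $\mathfrak B_j=\begin{pmatrix}0&1\\-\mathfrak p_0^{(j)}&-\mathfrak p_1^{(j)}\end{pmatrix}$ if $\mathfrak k_j=2$, superdiagonal blocks $\mathfrak D_j$ ($\mathfrak k_j\times\mathfrak k_{j+1}$, lower-left entry $1$, other entries $0$) and subdiagonal blocks $\mathfrak C_j$ ($\mathfrak k_{j+1}\times\mathfrak k_j$, lower-left entry $\mathfrak c_j$, other entries $0$). If $\mathfrak F$ is not normalized, the matrix associated with $\mathfrak F$ is by definition the one associated with $\mathfrak F/|\mathfrak s_{\mathfrak n_1-1}|$. Block $UL$-factorization of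 $J$ with parameter $s_{-1}$: put $\widehat P_j=Q_j+s_{-1}P_j$; let $\{\mathfrak n_j\}_{j\ge1}$ be the normal indices of $(s_{-1},s_0,s_1,\dots)$, $\mathfrak n_0=0$, and $\mathfrak k_j=\mathfrak n_{j+1}-\mathfrak n_j$, $j\in\mathbb Z_+$; one has $\widehat P_{\mathfrak n_j-1}(0)\neq0$, $j\in\mathbb N$. It is the factorization $J=\mathfrak U\mathfrak L$ in which $\mathfrak L$ is block lower bidiagonal with diagonal blocks $\mathfrak E_j$ and subdiagonal blocks $\mathfrak L_j$ ($\mathfrak k_j\times\mathfrak k_{j-1}$, in block row $j$, $j\ge1$, with lower-right entry $\mathfrak l_j$ and other entries $0$), $\mathfrak U$ is block upper bidiagonal with diagonal blocks $\mathfrak U_j$ and superdiagonal blocks $\mathfrak D_j$ ($\mathfrak k_j\times\mathfrak k_{j+1}$, lower-left entry $1$, other entries $0$), where $\mathfrak U_j=\mathfrak u_j$, $\mathfrak E_j=1$ if $\mathfrak k_j=1$ and $\mathfrak U_j=\begin{pmatrix}0&1\\ \mathfrak u_j&0\end{pmatrix}$, $\mathfrak E_j=\begin{pmatrix}1&0\\ \mathfrak e_j&1\end{pmatrix}$ if $\mathfrak k_j=2$, and $\mathfrak l_j=-\widehat P_{\mathfrak n_{j+1}-1}(0)/\widehat P_{\mathfrak n_j-1}(0)$, $j\in\mathbb N$. *)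

theory Defs
  imports
    "HOL-Complex_Analysis.Complex_Analysis"
    "HOL-Library.Landau_Symbols"
    "HOL-Library.Infinite_Set"
    "Jordan_Normal_Form.Determinant"
begin

section \<open>Nevanlinna functions and the classes \<open>D\<^sup>+\<close>, \<open>D\<^sup>-\<close>\<close>

text \<open>
  Functions on the open upper half plane are total functions on the complex numbers; only their
  values on \<open>upper_hp\<close> matter. Two meromorphic functions are regarded as equal if they agree off a
  set without accumulation points in \<open>upper_hp\<close>, i.e. \<open>\<forall>\<^sub>\<approx>z\<in>upper_hp. f z = g z\<close>; this
  makes the values \<open>1 / 0 = 0\<close> at poles irrelevant.
\<close>

definition upper_hp :: "complex set" where
  "upper_hp = {z. 0 < Im z}"

definition sector_at_infinity :: "real \<Rightarrow> complex filter" where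
  "sector_at_infinity \<epsilon> = inf at_infinity (principal {z. \<epsilon> < Arg z \<and> Arg z < pi - \<epsilon>})"

text \<open>\<open>F(z) \<sim> - \<Sum>\<^sub>j s\<^sub>j z\<^bsup>-j-1\<^esup>\<close> as \<open>z\<close> tends nontangentially to infinity.\<close>

definition nt_expansion :: "(complex \<Rightarrow> complex) \<Rightarrow> (nat \<Rightarrow> real) \<Rightarrow> bool" where
  "nt_expansion F s \<longleftrightarrow>
     (\<forall>n. \<forall>\<epsilon>>0. (\<lambda>z. F z - (- (\<Sum>j\<le>2*n. of_real (s j) / z ^ (j + 1))))
                    \<in> o[sector_at_infinity \<epsilon>](\<lambda>z. 1 / z ^ (2*n + 1)))"

definition Nevanlinna :: "(complex \<Rightarrow> complex) set" where
  "Nevanlinna = {F. F holomorphic_on upper_hp \<and> F ` upper_hp \<subseteq> upper_hp}"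

definition N_minus_infinity :: "(complex \<Rightarrow> complex) set" where
  "N_minus_infinity = {F \<in> Nevanlinna. \<exists>s. nt_expansion F s}"

definition D_plus :: "(complex \<Rightarrow> complex) set" where
  "D_plus = {F. F meromorphic_on upper_hp \<and>
     (\<exists>s. nt_expansion F s \<and> (\<lambda>z. z * F z + of_real (s 0)) \<in> N_minus_infinity)}"

definition D_minus :: "(complex \<Rightarrow> complex) set" where
  "D_minus = {F. F meromorphic_on upper_hp \<and>
     (\<exists>r::real. r \<noteq> 0 \<and> (\<lambda>z. - of_real r / z + F z / z) \<in> N_minus_infinity)}"

definition rational_on_upper_hp :: "(complex \<Rightarrow> complex) \<Rightarrow> bool" where
  "rational_on_upper_hp F \<longleftrightarrow>
     (\<exists>p q :: complex poly. q \<noteq> 0 \<and> (\<forall>\<^sub>\<approx>z\<in>upper_hp. F z = poly p z / poly q z))"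


section \<open>Semi-infinite matrices\<close>

type_synonym inf_mat = "nat \<Rightarrow> nat \<Rightarrow> real"

text \<open>All matrices below are banded, so every series here has finitely many nonzero terms.\<close>

definition inf_mat_mult :: "inf_mat \<Rightarrow> inf_mat \<Rightarrow> inf_mat" (infixl \<open>\<odot>\<close> 70) where
  "(A \<odot> B) i k = (\<Sum>m. A i m * B m k)"

text \<open>
  For \<open>0 = n\<^sub>0 < n\<^sub>1 < \<dots>\<close>, block \<open>j\<close> consists of the indices \<open>n\<^sub>j \<le> i < n\<^sub>j\<^sub>+\<^sub>1\<close>;
  \<open>Blk p q\<close> is the block in block row \<open>p\<close> and block column \<open>q\<close>.
\<close>

definition block_index :: "(nat \<Rightarrow> nat) \<Rightarrow> nat \<Rightarrow> nat" where
  "block_index n i = (LEAST j. i < n (Suc j))"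

definition assemble_blocks :: "(nat \<Rightarrow> nat) \<Rightarrow> (nat \<Rightarrow> nat \<Rightarrow> real Matrix.mat) \<Rightarrow> inf_mat" where
  "assemble_blocks n Blk i k =
     (let p = block_index n i; q = block_index n k in Blk p q $$ (i - n p, k - n q))"

definition lower_left :: "nat \<Rightarrow> nat \<Rightarrow> real \<Rightarrow> real Matrix.mat" where
  "lower_left r c x = Matrix.mat r c (\<lambda>(a, b). if a = r - 1 \<and> b = 0 then x else 0)"

definition lower_right :: "nat \<Rightarrow> nat \<Rightarrow> real \<Rightarrow> real Matrix.mat" where
  "lower_right r c x = Matrix.mat r c (\<lambda>(a, b). if a = r - 1 \<and> b = c - 1 then x else 0)"


section \<open>Normal indices\<close>

definition normal_indices :: "(nat \<Rightarrow> real) \<Rightarrow> nat set" where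
  "normal_indices s =
     {n. 1 \<le> n \<and> Determinant.det (Matrix.mat n n (\<lambda>(i, k). s (i + k))) \<noteq> 0}"

definition normal_index :: "(nat \<Rightarrow> real) \<Rightarrow> nat \<Rightarrow> nat" where
  "normal_index s j = (case j of 0 \<Rightarrow> 0 | Suc i \<Rightarrow> enumerate (normal_indices s) i)"

definition block_size :: "(nat \<Rightarrow> nat) \<Rightarrow> nat \<Rightarrow> nat" where
  "block_size n j = n (Suc j) - n j"


section \<open>The monic Jacobi matrix of a function\<close>

definition moment :: "real measure \<Rightarrow> nat \<Rightarrow> real" where
  "moment \<sigma> j = (\<integral>t. t ^ j \<partial>\<sigma>)"

definition represents :: "real measure \<Rightarrow> (complex \<Rightarrow> complex) \<Rightarrow> bool" where
  "represents \<sigma> F \<longleftrightarrow>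
     sets \<sigma> = sets borel \<and> finite_measure \<sigma> \<and>
     (\<forall>j. integrable \<sigma> (\<lambda>t. t ^ j)) \<and>
     (\<forall>z\<in>upper_hp. F z = (\<integral>t. 1 / (of_real t - z) \<partial>\<sigma>))"

text \<open>Orthogonality with respect to \<open>\<sigma>\<close> and to \<open>\<sigma> / s\<^sub>0\<close> is the same condition.\<close>

definition monic_orthogonal :: "real measure \<Rightarrow> (nat \<Rightarrow> real poly) \<Rightarrow> bool" where
  "monic_orthogonal \<sigma> P \<longleftrightarrow>
     (\<forall>j. Polynomial.degree (P j) = j \<and> lead_coeff (P j) = 1) \<and>
     (\<forall>i j. i \<noteq> j \<longrightarrow> (\<integral>t. poly (P i) t * poly (P j) t \<partial>\<sigma>) = 0)"

definition three_term_recurrence ::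
    "(nat \<Rightarrow> real poly) \<Rightarrow> (nat \<Rightarrow> real) \<Rightarrow> (nat \<Rightarrow> real) \<Rightarrow> bool" where
  "three_term_recurrence P b c \<longleftrightarrow>
     (\<forall>j. [:0, 1:] * P j = P (Suc j) + Polynomial.smult (b j) (P j)
                            + (case j of 0 \<Rightarrow> 0 | Suc i \<Rightarrow> Polynomial.smult (c i) (P i)))"

definition monic_jacobi :: "(nat \<Rightarrow> real) \<Rightarrow> (nat \<Rightarrow> real) \<Rightarrow> inf_mat" where
  "monic_jacobi b c i k =
     (if k = i then b i else if k = Suc i then 1 else if i = Suc k then c k else 0)"

text \<open>
  \<open>J\<close> is the monic Jacobi matrix of \<open>F\<close>, where \<open>\<sigma>\<close> is the measure representing \<open>F\<close> and \<open>P\<close> the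
  sequence of polynomials of the first kind.
\<close>

definition monic_jacobi_of ::
    "(complex \<Rightarrow> complex) \<Rightarrow> real measure \<Rightarrow> (nat \<Rightarrow> real poly) \<Rightarrow> inf_mat \<Rightarrow> bool" where
  "monic_jacobi_of F \<sigma> P J \<longleftrightarrow>
     represents \<sigma> F \<and> monic_orthogonal \<sigma> P \<and>
     (\<exists>b c. (\<forall>j. c j > 0) \<and> three_term_recurrence P b c \<and> J = monic_jacobi b c)"


section \<open>Block \<open>UL\<close>-factorization\<close>

text \<open>The difference quotient is a polynomial in \<open>t\<close>; at \<open>t = x\<close> its value is the derivative.
  The case distinction matters because \<open>\<sigma>\<close> may have an atom at \<open>x\<close>.\<close>

definition second_kind :: "real measure \<Rightarrow> (nat \<Rightarrow> real poly) \<Rightarrow> nat \<Rightarrow> real \<Rightarrow> real" where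
  "second_kind \<sigma> P j x =
     (\<integral>t. (if t = x then poly (pderiv (P j)) x
           else (poly (P j) x - poly (P j) t) / (x - t)) \<partial>\<sigma>)"

definition P_hat :: "real measure \<Rightarrow> (nat \<Rightarrow> real poly) \<Rightarrow> real \<Rightarrow> nat \<Rightarrow> real \<Rightarrow> real" where
  "P_hat \<sigma> P s j x = second_kind \<sigma> P j x + s * poly (P j) x"

definition U_factor :: "(nat \<Rightarrow> nat) \<Rightarrow> (nat \<Rightarrow> real) \<Rightarrow> inf_mat" where
  "U_factor n u = (let k = block_size n in assemble_blocks n (\<lambda>i j.
     if j = i then
       (if k i = 1 then mat_of_rows_list 1 [[u i]] else mat_of_rows_list 2 [[0, 1], [u i, 0]])
     else if j = Suc i then lower_left (k i) (k j) 1
     else 0\<^sub>m (k i) (k j)))"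

definition L_factor :: "(nat \<Rightarrow> nat) \<Rightarrow> (nat \<Rightarrow> real) \<Rightarrow> (nat \<Rightarrow> real) \<Rightarrow> inf_mat" where
  "L_factor n e l = (let k = block_size n in assemble_blocks n (\<lambda>i j.
     if j = i then
       (if k i = 1 then mat_of_rows_list 1 [[1]] else mat_of_rows_list 2 [[1, 0], [e i, 1]])
     else if i = Suc j then lower_right (k i) (k j) (l i)
     else 0\<^sub>m (k i) (k j)))"

text \<open>The parameter \<open>s\<close> is \<open>s\<^bsub>-1\<^esub>\<close>, and \<open>case_nat s (moment \<sigma>)\<close> is the sequence
  \<open>(s\<^bsub>-1\<^esub>, s\<^sub>0, s\<^sub>1, \<dots>)\<close>.\<close>

definition block_UL_factorization ::
    "real measure \<Rightarrow> (nat \<Rightarrow> real poly) \<Rightarrow> real \<Rightarrow> inf_mat \<Rightarrow> inf_mat \<Rightarrow> inf_mat \<Rightarrow> bool" where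
  "block_UL_factorization \<sigma> P s J U L \<longleftrightarrow>
     (let n = normal_index (case_nat s (moment \<sigma>));
          l = (\<lambda>j. - P_hat \<sigma> P s (n (Suc j) - 1) 0 / P_hat \<sigma> P s (n j - 1) 0)
      in (\<exists>u e. U = U_factor n u \<and> L = L_factor n e l) \<and> J = U \<odot> L)"


section \<open>The monic generalized Jacobi matrix of a function\<close>

definition first_nonzero :: "(nat \<Rightarrow> real) \<Rightarrow> real" where
  "first_nonzero s = s (LEAST j. s j \<noteq> 0)"

abbreviation cpoly :: "real poly \<Rightarrow> complex \<Rightarrow> complex" where
  "cpoly p \<equiv> poly (map_poly of_real p)"

text \<open>
  The data of the recursion \<open>- 1 / F\<^sub>j = \<epsilon>\<^sub>j p\<^sub>j + \<beta>\<^sub>j\<^sup>2 F\<^sub>j\<^sub>+\<^sub>1\<close> started at \<open>F\<^sub>0 = F\<close>; the condition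
  \<open>\<epsilon>\<^sub>j \<in> {1, -1}\<close> says that every \<open>F\<^sub>j\<close> is normalized.
\<close>

definition continued_fraction_data ::
    "(complex \<Rightarrow> complex) \<Rightarrow> (nat \<Rightarrow> nat) \<Rightarrow> (nat \<Rightarrow> real) \<Rightarrow> (nat \<Rightarrow> real poly) \<Rightarrow> (nat \<Rightarrow> real) \<Rightarrow> bool"
  where
  "continued_fraction_data F k \<epsilon> p \<beta> \<longleftrightarrow>
     (\<exists>G. G 0 = F \<and>
       (\<forall>j. G j meromorphic_on upper_hp \<and>
            (\<exists>s. nt_expansion (G j) s \<and> \<epsilon> j = first_nonzero s) \<and> \<epsilon> j \<in> {1, -1} \<and>
            Polynomial.degree (p j) = k j \<and> lead_coeff (p j) = 1 \<and>
            (\<forall>\<theta>>0. (\<lambda>z. - 1 / G j z - of_real (\<epsilon> j) * cpoly (p j) z)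
                       \<in> o[sector_at_infinity \<theta>](\<lambda>_. 1)) \<and>
            \<beta> j > 0 \<and>
            (\<forall>\<^sub>\<approx>z\<in>upper_hp. - 1 / G j z =
               of_real (\<epsilon> j) * cpoly (p j) z + of_real ((\<beta> j)\<^sup>2) * G (Suc j) z)))"

definition generalized_jacobi ::
    "(nat \<Rightarrow> nat) \<Rightarrow> (nat \<Rightarrow> real poly) \<Rightarrow> (nat \<Rightarrow> real) \<Rightarrow> inf_mat" where
  "generalized_jacobi n p c = (let k = block_size n in assemble_blocks n (\<lambda>i j.
     if j = i then
       (if k i = 1 then mat_of_rows_list 1 [[- Polynomial.coeff (p i) 0]]
        else mat_of_rows_list 2 [[0, 1], [- Polynomial.coeff (p i) 0, - Polynomial.coeff (p i) 1]])
     else if j = Suc i then lower_left (k i) (k j) 1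
     else if i = Suc j then lower_left (k i) (k j) (c j)
     else 0\<^sub>m (k i) (k j)))"

text \<open>
  The matrix is read off from \<open>F\<close> divided by the modulus of its first nonzero asymptotic
  coefficient; for normalized \<open>F\<close> this division has no effect.
\<close>

definition monic_generalized_jacobi_of :: "(complex \<Rightarrow> complex) \<Rightarrow> inf_mat \<Rightarrow> bool" where
  "monic_generalized_jacobi_of F M \<longleftrightarrow>
     F \<in> D_plus \<union> D_minus \<and> \<not> rational_on_upper_hp F \<and>
     (\<exists>s \<epsilon> p \<beta>.
        nt_expansion F s \<and>
        continued_fraction_data (\<lambda>z. F z / of_real \<bar>first_nonzero s\<bar>)
          (block_size (normal_index s)) \<epsilon> p \<beta> \<and>
        M = generalized_jacobi (normal_index s) p (\<lambda>j. \<epsilon> j * \<epsilon> (Suc j) * (\<beta> j)\<^sup>2))"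

end

theory Submission
  imports Defs
begin

text \<open>
  Write $b_j$, $c_j$ for the entries of $J$, let $C_0 = s_0$ and $C_m = c_{m-1}$ for $m \ge 1$.
  Two sequences solve the recurrence of $J$, shifted by one index so that it starts uniformly:
  \<^item> the functions of the second kind, $\Phi_0 = -1$ and
    $\Phi_{m+1}(z) = \int P_m(t)/(t-z)\,d\sigma(t)$, with
    $z\Phi_{m+1} = \Phi_{m+2} + b_m\Phi_{m+1} + C_m\Phi_m$;
  \<^item> the numbers $X_0 = -1$ and $X_{m+1} = \widehat P_m(0)$, which satisfy the same recurrence
    at $z = 0$.

  Since all $C_m$ are positive, no two consecutive $X_m$ vanish. The Hankel determinant of size $m \ge 1$ of
  $(s_{-1}, s_0, \dots)$ vanishes iff $X_m = 0$ (\<open>normal_iff_X\<close>). So $n_0 < n_1 < \dots$ enumerate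
  exactly the $m$ with $X_m \ne 0$, and consecutive $n_j$ differ by $1$ or $2$.

  The passage from $UL$ to $LU$ is a Christoffel transformation with node $0$. Put $a_j = -X_{n_j+1}/X_{n_j}$
  and $T_j = \Phi_{n_j+1} + a_j\Phi_{n_j}$, a Casorati determinant of $\Phi$ and $X$ up to a factor.
  Then the factors $U$ and $L$ give the two first order relations
  $T_{j+1} = q_jT_j - l_jz\Phi_{n_j}$ and $z\Phi_{n_{j+1}} = T_{j+1} + u_jT_j$
  (\<open>T_Suc\<close>, \<open>Phi_n_Suc\<close>), where $q_j$ is $z - u_j$ or $z^2 - b_{n_j}z - u_j$
  according to the block size, and $l_j = -X_{n_{j+1}}/X_{n_j}$ also for $j = 0$. Eliminating $\Phi$ gives
  $T_{j+2} = p_{j+1}T_{j+1} - l_{j+1}u_jT_j$, where $p_j = q_j - l_j$ for $j \ge 1$ and $p_0 = q_0$.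
  These are exactly the polynomials and the coupling coefficients that are read off the matrix $LU$
  (\<open>LU_eq_generalized_jacobi\<close>).

  It remains to see that this recurrence is the continued fraction. Orthogonality gives
  $z^m\Phi_m(z) \to -C_0 \cdots C_{m-1}$ with a complete asymptotic expansion, hence
  $z^{n_{j+1}-1}T_j$ has a complete expansion with nonzero limit $r_j$, and $r_{j+1}/r_j = l_{j+1}u_j$. Consequently
  $G_j = -\epsilon_j\,(T_j/r_j)/(T_{j-1}/r_{j-1})$ with $\epsilon_j = -\mathrm{sgn}\,r_j$ (and $T_{-1} = z$, $r_{-1} = 1$)
  is normalized, $G_0$ is the normalized transform of $F$, and the recurrence of $T$ becomes
  $-1/G_j = \epsilon_jp_j + |r_{j+1}/r_j|\,G_{j+1}$ with $G_{j+1} \to 0$.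
\<close>

section \<open>Asymptotic expansions in sectors\<close>

text \<open>
  The first \<open>N\<close> terms of $\sum_i A_iz^{-i}$.
\<close>
abbreviation partial_sum :: "real fps \<Rightarrow> nat \<Rightarrow> complex \<Rightarrow> complex" where
  "partial_sum A N z \<equiv> (\<Sum>i<N. of_real (fps_nth A i) / z ^ i)"

text \<open>
  Complete asymptotic expansion $f(z) \sim \sum_i A_iz^{-i}$ along a filter \<open>\<F>\<close>. The coefficients are kept
  as a formal power series in $1/z$, so that products and quotients of functions correspond to
  products and quotients of power series.
\<close>
definition expands :: "complex filter \<Rightarrow> (complex \<Rightarrow> complex) \<Rightarrow> real fps \<Rightarrow> bool" where
  "expands \<F> f A \<longleftrightarrow>
     (\<forall>N. (\<lambda>z. f z - partial_sum A N z) \<in> O[\<F>](\<lambda>z. 1 / z ^ N))"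

lemma expandsD: "expands \<F> f A \<Longrightarrow> (\<lambda>z. f z - partial_sum A N z) \<in> O[\<F>](\<lambda>z. 1 / z ^ N)"
  by (simp add: expands_def)

lemma expands_bounded: "expands \<F> f A \<Longrightarrow> f \<in> O[\<F>](\<lambda>_. 1)"
  using expandsD[of \<F> f A 0] by simp

lemma expands_cong:
  assumes "expands \<F> f A" "eventually (\<lambda>z. f z = g z) \<F>"
  shows "expands \<F> g A"
  unfolding expands_def
proof
  fix N
  have "eventually (\<lambda>z. f z - partial_sum A N z = g z - partial_sum A N z) \<F>"
    using assms(2) by eventually_elim simp
  from landau_o.big.in_cong[OF this] expandsD[OF assms(1)]
  show "(\<lambda>z. g z - partial_sum A N z) \<in> O[\<F>](\<lambda>z. 1 / z ^ N)"
    by (rule iffD1)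
qed

lemma expands_diff:
  assumes "expands \<F> f A" "expands \<F> g B" shows "expands \<F> (\<lambda>z. f z - g z) (A - B)"
  unfolding expands_def
proof
  fix N
  show "(\<lambda>z. f z - g z - partial_sum (A - B) N z) \<in> O[\<F>](\<lambda>z. 1 / z ^ N)"
    using sum_in_bigo(2)[OF expandsD[OF assms(1), of N] expandsD[OF assms(2), of N]]
    by (simp add: diff_divide_distrib sum_subtractf algebra_simps)
qed

context
  fixes \<F> :: "complex filter"
  assumes at_infinity: "\<F> \<le> at_infinity"
begin

lemma power_inverse_bigo: "m \<ge> n \<Longrightarrow> (\<lambda>z. 1 / z ^ m) \<in> O[\<F>](\<lambda>z. 1 / z ^ n)"
proof -
  assume "m \<ge> n"
  have "eventually (\<lambda>z::complex. 1 \<le> norm z) \<F>"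
    using at_infinity
    by (rule filter_leD) (auto simp: eventually_at_infinity)
  then have "eventually (\<lambda>z. norm (1 / z ^ m) \<le> 1 * norm (1 / z ^ n)) \<F>"
  proof eventually_elim
    case (elim z)
    have "1 / norm z ^ m \<le> 1 / norm z ^ n"
      using elim \<open>m \<ge> n\<close> by (intro frac_le power_increasing zero_less_power) auto
    then show ?case
      by (simp add: norm_divide norm_power)
  qed
  then show ?thesis
    by (rule bigoI)
qed

lemma scaled_power_inverse_bigo: "m \<ge> n \<Longrightarrow> (\<lambda>z. a / z ^ m) \<in> O[\<F>](\<lambda>z. 1 / z ^ n)"
  using landau_o.big.mult[OF _ power_inverse_bigo, of "\<lambda>_. a" "\<lambda>_. 1" n m] by simp

lemma expands_sum:
  "expands \<F> (\<lambda>z. partial_sum A M z) (fps_cutoff M A)"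
  unfolding expands_def
proof
  fix N
  have *: "partial_sum (fps_cutoff M A) N z = (\<Sum>i | i < N \<and> i < M. of_real (fps_nth A i) / z ^ i)" for z :: complex
    by (rule sum.mono_neutral_cong_right) (auto split: if_splits)
  have "partial_sum A M z - partial_sum (fps_cutoff M A) N z =
     (\<Sum>i\<in>{N..<M}. of_real (fps_nth A i) / z ^ i)" for z :: complex
  proof -
    have M: "{..<M} = {i. i < N \<and> i < M} \<union> {N..<M}" by auto
    have "partial_sum A M z =
        (\<Sum>i | i < N \<and> i < M. of_real (fps_nth A i) / z ^ i) + (\<Sum>i\<in>{N..<M}. of_real (fps_nth A i) / z ^ i)"
      unfolding M by (rule sum.union_disjoint) auto
    then show ?thesis unfolding * by simp
  qed
  then show "(\<lambda>z. partial_sum A M z - partial_sum (fps_cutoff M A) N z) \<in> O[\<F>](\<lambda>z. 1 / z ^ N)"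
    by (auto intro!: big_sum_in_bigo scaled_power_inverse_bigo)
qed

lemma expands_mult:
  assumes f: "expands \<F> f A" and g: "expands \<F> g B"
  shows "expands \<F> (\<lambda>z. f z * g z) (A * B)"
  unfolding expands_def
proof
  fix N
  define p where "p z = partial_sum A N z" for z :: complex
  define q where "q z = partial_sum B N z" for z :: complex
  have p: "p \<in> O[\<F>](\<lambda>_. 1)" and q: "q \<in> O[\<F>](\<lambda>_. 1)"
    using expands_bounded[OF expands_sum] by (simp_all add: p_def[abs_def] q_def[abs_def])
  have fp: "(\<lambda>z. f z - p z) \<in> O[\<F>](\<lambda>z. 1 / z ^ N)" and gq: "(\<lambda>z. g z - q z) \<in> O[\<F>](\<lambda>z. 1 / z ^ N)"
    using expandsD[OF f] expandsD[OF g] by (simp_all add: p_def q_def)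
  \<comment> \<open>Only the products of terms of total order at least \<open>N\<close> remain.\<close>
  have pq: "p z * q z - partial_sum (A * B) N z =
     (\<Sum>(i,j)\<in>{..<N} \<times> {..<N} - {(i,j). i + j < N}. of_real (fps_nth A i * fps_nth B j) / z ^ (i + j))" for z
  proof -
    let ?t = "\<lambda>(i,j). of_real (fps_nth A i * fps_nth B j) / z ^ (i + j)"
    have sub: "{(i,j). i + j < N} \<subseteq> {..<N} \<times> {..<N}" by auto
    have "p z * q z = sum ?t ({..<N} \<times> {..<N})"
      by (simp add: p_def q_def sum_product sum.cartesian_product power_add)
    also have "\<dots> = sum ?t ({..<N} \<times> {..<N} - {(i,j). i + j < N}) + sum ?t {(i,j). i + j < N}"
      by (rule sum.subset_diff[OF sub]) simp
    also have "sum ?t {(i,j). i + j < N} =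
        (\<Sum>k<N. \<Sum>i\<le>k. of_real (fps_nth A i * fps_nth B (k - i)) / z ^ (i + (k - i)))"
      by (rule sum.triangle_reindex)
    also have "\<dots> = partial_sum (A * B) N z"
      by (simp add: fps_mult_nth atLeast0AtMost sum_divide_distrib)
    finally show ?thesis by simp
  qed
  have "(\<lambda>z. p z * q z - partial_sum (A * B) N z) \<in> O[\<F>](\<lambda>z. 1 / z ^ N)"
    unfolding pq by (auto intro!: big_sum_in_bigo scaled_power_inverse_bigo)
  moreover have "(\<lambda>z. (f z - p z) * g z) \<in> O[\<F>](\<lambda>z. 1 / z ^ N)"
    using landau_o.big.mult[OF fp expands_bounded[OF g]] by simp
  moreover have "(\<lambda>z. p z * (g z - q z)) \<in> O[\<F>](\<lambda>z. 1 / z ^ N)"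
    using landau_o.big.mult[OF p gq] by simp
  ultimately have "(\<lambda>z. (p z * q z - partial_sum (A * B) N z) +
      ((f z - p z) * g z + p z * (g z - q z))) \<in> O[\<F>](\<lambda>z. 1 / z ^ N)"
    by (rule sum_in_bigo(1)[OF _ sum_in_bigo(1)])
  moreover have "(p z * q z - c) + ((f z - p z) * g z + p z * (g z - q z)) = f z * g z - c" for z c
    by (simp add: algebra_simps)
  ultimately show "(\<lambda>z. f z * g z - partial_sum (A * B) N z) \<in> O[\<F>](\<lambda>z. 1 / z ^ N)"
    by simp
qed

lemma expands_const: "expands \<F> (\<lambda>_. of_real a) (fps_const a)"
proof -
  have "partial_sum (fps_const a) N z = of_real a" if "N > 0" for N and z :: complex
    using that by (subst sum.mono_neutral_right[of _ "{0}"]) auto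
  then have "(\<lambda>z. of_real a - partial_sum (fps_const a) N z) \<in> O[\<F>](\<lambda>z. 1 / z ^ N)" for N
    by (cases "N = 0") auto
  then show ?thesis
    by (simp add: expands_def)
qed

lemma expands_inverse_power: "expands \<F> (\<lambda>z. 1 / z ^ k) (fps_X ^ k)"
proof -
  have "(\<Sum>i<Suc k. of_real (fps_nth (fps_X ^ k) i) / z ^ i) = 1 / z ^ k" for z :: complex
    by (subst sum.mono_neutral_right[of _ "{k}"]) auto
  moreover have "fps_cutoff (Suc k) (fps_X ^ k :: real fps) = fps_X ^ k"
    by (rule fps_ext) auto
  ultimately show ?thesis
    using expands_sum[of "fps_X ^ k" "Suc k"] by simp
qed

lemma expands_tendsto:
  assumes "expands \<F> f A" shows "(f \<longlongrightarrow> of_real (fps_nth A 0)) \<F>"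
proof -
  have "((\<lambda>z::complex. 1 / z) \<longlongrightarrow> 0) \<F>"
    by (rule tendsto_mono[OF at_infinity]) (rule tendsto_divide_0[OF tendsto_const filterlim_ident])
  then have "(\<lambda>z::complex. 1 / z) \<in> o[\<F>](\<lambda>_. 1)"
    by (intro smalloI_tendsto) auto
  then have "(\<lambda>z. f z - of_real (fps_nth A 0)) \<in> o[\<F>](\<lambda>_. 1)"
    using expandsD[OF assms, of 1] landau_o.big_small_trans by auto
  then have "((\<lambda>z. (f z - of_real (fps_nth A 0)) / 1) \<longlongrightarrow> 0) \<F>"
    by (rule smalloD_tendsto)
  then show ?thesis
    using Lim_null[of f "of_real (fps_nth A 0)" \<F>] by simp
qed

text \<open>
  With $q$ the truncation of $A^{-1}$ at order $N$, the product $fq$ has an expansion whose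
  first $N$ coefficients agree with those of $1$; hence $1/f - q = (1 - fq)/f = O(z^{-N})$.
\<close>
lemma expands_inverse:
  assumes f: "expands \<F> f A" and A: "fps_nth A 0 \<noteq> 0"
  shows "expands \<F> (\<lambda>z. 1 / f z) (inverse A)"
  unfolding expands_def
proof
  fix N
  define q where "q z = partial_sum (inverse A) N z" for z :: complex
  have lim: "(f \<longlongrightarrow> of_real (fps_nth A 0)) \<F>" by (rule expands_tendsto[OF f])
  have nz: "eventually (\<lambda>z. f z \<noteq> 0) \<F>"
    using tendsto_imp_eventually_ne[OF lim] A by simp
  have bounded: "(\<lambda>z. 1 / f z) \<in> O[\<F>](\<lambda>_. 1)"
    by (rule bigoI_tendsto) (use A in \<open>auto intro!: tendsto_divide[OF tendsto_const lim]\<close>)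
  have "expands \<F> (\<lambda>z. f z * q z) (A * fps_cutoff N (inverse A))"
    unfolding q_def by (rule expands_mult[OF f expands_sum])
  from expandsD[OF this, of N]
  have "(\<lambda>z. f z * q z - partial_sum (1::real fps) N z) \<in> O[\<F>](\<lambda>z. 1 / z ^ N)"
  proof -
    have "fps_nth (A * fps_cutoff N (inverse A)) i = fps_nth 1 i" if "i < N" for i
    proof -
      have "fps_nth (A * fps_cutoff N (inverse A)) i = fps_nth (A * inverse A) i"
        unfolding fps_mult_nth using that by (intro sum.cong) auto
      also have "A * inverse A = 1"
        using inverse_mult_eq_1[OF A] by (simp add: mult.commute)
      finally show ?thesis .
    qed
    then have "partial_sum (A * fps_cutoff N (inverse A)) N z = partial_sum (1::real fps) N z" for z :: complex
      by (intro sum.cong) auto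
    then show ?thesis using \<open>(\<lambda>z. _ z - _ z) \<in> _\<close> by simp
  qed
  moreover have "(\<lambda>z. 1 - partial_sum (1::real fps) N z) \<in> O[\<F>](\<lambda>z. 1 / z ^ N)"
    using expandsD[OF expands_const[of 1], of N] by simp
  ultimately have "(\<lambda>z. (1 - partial_sum (1::real fps) N z) -
      (f z * q z - partial_sum (1::real fps) N z)) \<in> O[\<F>](\<lambda>z. 1 / z ^ N)"
    by (rule sum_in_bigo(2)[rotated])
  then have "(\<lambda>z. 1 - f z * q z) \<in> O[\<F>](\<lambda>z. 1 / z ^ N)"
    by simp
  from landau_o.big.mult[OF bounded this]
  have *: "(\<lambda>z. 1 / f z * (1 - f z * q z)) \<in> O[\<F>](\<lambda>z. 1 / z ^ N)" by simp
  have "eventually (\<lambda>z. 1 / f z * (1 - f z * q z) = 1 / f z - q z) \<F>"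
    using nz by eventually_elim (simp add: field_simps)
  from landau_o.big.in_cong[OF this]
  have "(\<lambda>z. 1 / f z - q z) \<in> O[\<F>](\<lambda>z. 1 / z ^ N)"
    using * by (rule iffD1)
  then show "(\<lambda>z. 1 / f z - partial_sum (inverse A) N z) \<in> O[\<F>](\<lambda>z. 1 / z ^ N)"
    by (simp add: q_def)
qed

end

lemma sector_le_at_infinity: "sector_at_infinity \<theta> \<le> at_infinity"
  by (simp add: sector_at_infinity_def)

lemma eventually_sector:
  "eventually (\<lambda>z. z \<noteq> 0 \<and> \<theta> < Arg z \<and> Arg z < pi - \<theta>) (sector_at_infinity \<theta>)"
proof -
  have "eventually (\<lambda>z::complex. z \<noteq> 0) at_infinity"
    unfolding eventually_at_infinity by (rule exI[of _ 1]) auto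
  then show ?thesis
    by (auto simp: sector_at_infinity_def eventually_inf_principal elim!: eventually_mono)
qed

lemma eventually_sector_Im:
  assumes "\<theta> > 0"
  shows "eventually (\<lambda>z. z \<in> upper_hp \<and> norm z * sin \<theta> \<le> Im z \<and> sin \<theta> > 0) (sector_at_infinity \<theta>)"
  using eventually_sector
proof eventually_elim
  fix z :: complex
  assume z: "z \<noteq> 0 \<and> \<theta> < Arg z \<and> Arg z < pi - \<theta>"
  have Im: "Im z = norm z * sin (Arg z)"
    by (metis Im_rcis rcis_cmod_Arg)
  have "sin \<theta> \<le> sin (Arg z)"
  proof (cases "Arg z \<le> pi / 2")
    case True
    then show ?thesis using z assms by (intro sin_monotone_2pi_le) auto
  next
    case False
    then have "sin \<theta> \<le> sin (pi - Arg z)" using z assms by (intro sin_monotone_2pi_le) auto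
    then show ?thesis by simp
  qed
  moreover have "sin \<theta> > 0" using z assms by (intro sin_gt_zero) linarith+
  ultimately show "z \<in> upper_hp \<and> norm z * sin \<theta> \<le> Im z \<and> sin \<theta> > 0"
    using z by (auto simp: upper_hp_def Im intro!: mult_left_mono mult_pos_pos)
qed

lemma nt_expansion_of_expands:
  assumes f: "\<And>\<theta>. \<theta> > 0 \<Longrightarrow> expands (sector_at_infinity \<theta>) f A" and "fps_nth A 0 = 0"
  shows "nt_expansion f (\<lambda>j. - fps_nth A (Suc j))"
  unfolding nt_expansion_def
proof (intro allI impI)
  fix n :: nat and \<theta> :: real
  assume \<theta>: "\<theta> > 0"
  let ?S = "sector_at_infinity \<theta>"
  have "(\<lambda>z. f z - (\<Sum>i<Suc (Suc (2*n)). of_real (fps_nth A i) / z ^ i)) \<in> O[?S](\<lambda>z. 1 / z ^ (2*n+2))"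
    using expandsD[OF f[OF \<theta>], of "Suc (Suc (2*n))"] by simp
  also have "(\<lambda>z. \<Sum>i<Suc (Suc (2*n)). of_real (fps_nth A i) / z ^ i) =
     (\<lambda>z. - (\<Sum>j\<le>2*n. of_real (- fps_nth A (Suc j)) / z ^ (j + 1)) :: complex)"
    by (subst sum.lessThan_Suc_shift) (simp add: assms(2) lessThan_Suc_atMost sum_negf)
  also have "(\<lambda>z::complex. 1 / z ^ (2*n+2)) \<in> o[?S](\<lambda>z. 1 / z ^ (2*n+1))"
  proof (rule smalloI_tendsto)
    have "((\<lambda>z::complex. 1 / z) \<longlongrightarrow> 0) ?S"
      by (rule tendsto_mono[OF sector_le_at_infinity]) (rule tendsto_divide_0[OF tendsto_const filterlim_ident])
    then show "((\<lambda>z::complex. 1 / z ^ (2*n+2) / (1 / z ^ (2*n+1))) \<longlongrightarrow> 0) ?S"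
      by (rule Lim_transform_eventually)
         (use eventually_sector[of \<theta>] in \<open>auto elim!: eventually_mono simp: field_simps\<close>)
    show "eventually (\<lambda>z::complex. 1 / z ^ (2*n+1) \<noteq> 0) ?S"
      using eventually_sector[of \<theta>] by (auto elim!: eventually_mono)
  qed
  finally show "(\<lambda>z. f z - - (\<Sum>j\<le>2 * n. complex_of_real (- fps_nth A (Suc j)) / z ^ (j + 1)))
    \<in> o[?S](\<lambda>z. 1 / z ^ (2 * n + 1))" .
qed

text \<open>
  A function that behaves like $A_0z^{-k}$ with $A_0 \ne 0$ has $-A_0$ as its first nonzero
  asymptotic coefficient, because \<^const>\<open>nt_expansion\<close> carries a minus sign.
\<close>
lemma nt_expansion_leading:
  assumes f: "\<And>\<theta>. \<theta> > 0 \<Longrightarrow> expands (sector_at_infinity \<theta>) (\<lambda>z. z ^ k * f z) A"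
    and "k \<ge> 1" "fps_nth A 0 \<noteq> 0"
  shows "\<exists>s. nt_expansion f s \<and> first_nonzero s = - fps_nth A 0"
proof (intro exI conjI)
  let ?B = "fps_X ^ k * A"
  have "expands (sector_at_infinity \<theta>) f ?B" if "\<theta> > 0" for \<theta>
    by (rule expands_cong[OF expands_mult[OF sector_le_at_infinity expands_inverse_power[OF sector_le_at_infinity] f[OF that]]])
       (rule eventually_mono[OF eventually_sector[of \<theta>]], simp)
  then show "nt_expansion f (\<lambda>j. - fps_nth ?B (Suc j))"
    by (rule nt_expansion_of_expands) (use \<open>k \<ge> 1\<close> in \<open>simp only: fps_X_power_mult_nth, simp\<close>)
  have "(LEAST j. - fps_nth ?B (Suc j) \<noteq> 0) = k - 1"
    by (rule Least_equality) (use assms(2,3) in \<open>auto simp: fps_X_power_mult_nth split: if_splits\<close>)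
  then show "first_nonzero (\<lambda>j. - fps_nth ?B (Suc j)) = - fps_nth A 0"
    using \<open>k \<ge> 1\<close> by (simp add: first_nonzero_def fps_X_power_mult_nth)
qed

section \<open>Moment functionals and normal indices\<close>

text \<open>
  The linear functional on polynomials that sends $t^k$ to $s_k$.
\<close>
definition moment_functional :: "(nat \<Rightarrow> real) \<Rightarrow> real poly \<Rightarrow> real" where
  "moment_functional s q = (\<Sum>k\<le>Polynomial.degree q. Polynomial.coeff q k * s k)"

lemma moment_functional_altdef:
  assumes "Polynomial.degree q \<le> N"
  shows "moment_functional s q = (\<Sum>k\<le>N. Polynomial.coeff q k * s k)"
  unfolding moment_functional_def
  by (rule sum.mono_neutral_left) (use assms in \<open>auto simp: coeff_eq_0\<close>)

lemma moment_functional_0 [simp]: "moment_functional s 0 = 0"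
  by (simp add: moment_functional_def)

lemma moment_functional_add:
  "moment_functional s (p + q) = moment_functional s p + moment_functional s q"
  using moment_functional_altdef[of p "max (Polynomial.degree p) (Polynomial.degree q)" s]
    moment_functional_altdef[of q "max (Polynomial.degree p) (Polynomial.degree q)" s]
    moment_functional_altdef[of "p + q" "max (Polynomial.degree p) (Polynomial.degree q)" s]
  by (simp add: degree_add_le_max sum.distrib distrib_right)

lemma moment_functional_smult:
  "moment_functional s (Polynomial.smult a q) = a * moment_functional s q"
  by (cases "a = 0") (simp_all add: moment_functional_def sum_distrib_left mult.assoc)

lemma moment_functional_diff:
  "moment_functional s (p - q) = moment_functional s p - moment_functional s q"
  using moment_functional_add[of s "p - q" q] by simp

lemma moment_functional_pCons:
  "moment_functional s (pCons a q) = a * s 0 + moment_functional (\<lambda>k. s (Suc k)) q"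
  using moment_functional_altdef[of "pCons a q" "Suc (Polynomial.degree q)" s]
  by (simp add: degree_pCons_le sum.atMost_Suc_shift moment_functional_def del: sum.atMost_Suc)

lemma moment_functional_monom_mult:
  "moment_functional s (Polynomial.monom 1 i * q) = moment_functional (\<lambda>k. s (i + k)) q"
  by (induction i arbitrary: s) (simp_all add: monom_0 monom_Suc moment_functional_pCons)

lemma moment_functional_mult:
  assumes "Polynomial.degree p \<le> N"
  shows "moment_functional s (p * q) =
     (\<Sum>i\<le>N. Polynomial.coeff p i * moment_functional s (Polynomial.monom 1 i * q))"
proof -
  have "moment_functional s (p * q) =
     (\<Sum>i\<le>Polynomial.degree p. Polynomial.coeff p i * moment_functional s (Polynomial.monom 1 i * q))"
  proof (induction p arbitrary: s)
    case 0
    then show ?case by simp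
  next
    case (pCons a p)
    have *: "moment_functional s (pCons 0 r) = moment_functional (\<lambda>k. s (Suc k)) r" for r
      by (simp add: moment_functional_pCons)
    show ?case
    proof (cases "p = 0")
      case True
      then show ?thesis by (simp add: moment_functional_smult monom_0)
    next
      case False
      then show ?thesis
        by (simp add: moment_functional_add moment_functional_smult * pCons.IH sum.atMost_Suc_shift
              monom_0 monom_Suc del: sum.atMost_Suc)
    qed
  qed
  also have "\<dots> = (\<Sum>i\<le>N. Polynomial.coeff p i * moment_functional s (Polynomial.monom 1 i * q))"
    by (rule sum.mono_neutral_left) (use assms in \<open>auto simp: coeff_eq_0\<close>)
  finally show ?thesis .
qed

text \<open>
  The vectors in the kernel of the Hankel matrix of size $n$ are the coefficient vectors of the
  polynomials $q$ of degree less than $n$ for which the functional annihilates $t^iq$ for all $i < n$.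
\<close>
lemma normal_indices_iff:
  "n \<in> normal_indices s \<longleftrightarrow> 1 \<le> n \<and>
     (\<forall>q. Polynomial.degree q < n \<longrightarrow>
        (\<forall>i<n. moment_functional s (Polynomial.monom 1 i * q) = 0) \<longrightarrow> q = 0)"
proof (cases "1 \<le> n")
  case True
  let ?A = "Matrix.mat n n (\<lambda>(i, k). s (i + k))"
  have A: "?A \<in> carrier_mat n n" by simp
  have entry: "vec_index (?A *\<^sub>v v) i = (\<Sum>k<n. vec_index v k * s (i + k))"
    if "i < n" "v \<in> carrier_vec n" for i v
    using that by (simp add: scalar_prod_def atLeast0LessThan mult.commute)
  have mf: "moment_functional s (Polynomial.monom 1 i * q) = (\<Sum>k<n. Polynomial.coeff q k * s (i + k))"
    if "Polynomial.degree q < n" for i q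
  proof -
    have "{..n - 1} = {..<n}" using True by auto
    then show ?thesis
      using moment_functional_altdef[of q "n - 1" "\<lambda>k. s (i + k)"] that
      by (simp add: moment_functional_monom_mult)
  qed
  have "Determinant.det ?A = 0 \<longleftrightarrow>
     (\<exists>q. Polynomial.degree q < n \<and> q \<noteq> 0 \<and>
        (\<forall>i<n. moment_functional s (Polynomial.monom 1 i * q) = 0))"
    unfolding det_0_iff_vec_prod_zero[OF A]
  proof safe
    fix v :: "real Matrix.vec"
    assume v: "v \<in> carrier_vec n" "v \<noteq> 0\<^sub>v n" "?A *\<^sub>v v = 0\<^sub>v n"
    define q where "q = (\<Sum>k<n. Polynomial.monom (vec_index v k) k)"
    have coeff: "Polynomial.coeff q k = (if k < n then vec_index v k else 0)" for k
      by (auto simp: q_def coeff_sum)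
    have "Polynomial.degree q \<le> n - 1"
      by (rule degree_le) (auto simp: coeff)
    then have deg: "Polynomial.degree q < n" using True by simp
    have "q \<noteq> 0"
    proof
      assume "q = 0"
      then have "vec_index v k = 0" if "k < n" for k
        using coeff[of k] that by simp
      then show False using v by (auto intro!: eq_vecI)
    qed
    moreover have "moment_functional s (Polynomial.monom 1 i * q) = 0" if "i < n" for i
      using mf[OF deg, of i] entry[OF that v(1)] v(3) that by (simp add: coeff)
    ultimately show "\<exists>q. Polynomial.degree q < n \<and> q \<noteq> 0 \<and>
        (\<forall>i<n. moment_functional s (Polynomial.monom 1 i * q) = 0)"
      using deg by blast
  next
    fix q
    assume q: "Polynomial.degree q < n" "q \<noteq> 0"
      "\<forall>i<n. moment_functional s (Polynomial.monom 1 i * q) = 0"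
    define v where "v = Matrix.vec n (Polynomial.coeff q)"
    have v: "v \<in> carrier_vec n" by (simp add: v_def)
    have "v \<noteq> 0\<^sub>v n"
    proof
      assume "v = 0\<^sub>v n"
      then have "vec_index v (Polynomial.degree q) = 0" using q(1) by simp
      then show False using q(1,2) by (simp add: v_def)
    qed
    moreover have "?A *\<^sub>v v = 0\<^sub>v n"
    proof (rule eq_vecI)
      fix i assume "i < dim_vec (0\<^sub>v n :: real Matrix.vec)"
      then have i: "i < n" by simp
      show "vec_index (?A *\<^sub>v v) i = vec_index (0\<^sub>v n) i"
        unfolding entry[OF i v] using mf[OF q(1), of i] q(3) i by (simp add: v_def)
    qed simp
    ultimately show "\<exists>v. v \<in> carrier_vec n \<and> v \<noteq> 0\<^sub>v n \<and> ?A *\<^sub>v v = 0\<^sub>v n"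
      using v by blast
  qed
  then show ?thesis
    using True by (auto simp: normal_indices_def)
qed (auto simp: normal_indices_def)

section \<open>Three-term recurrences and the Christoffel transformation\<close>

text \<open>
  Monic polynomials \<open>P\<close> with a three-term recurrence with positive \<open>c\<close>, of which all but $P_0$ are annihilated by
  the functional of \<open>\<mu>\<close>; orthogonality follows from the recurrence. The number \<open>s\<close> is $s_{-1}$, a moment
  put in front of the sequence \<open>\<mu>\<close>.
\<close>
locale orthogonal_recurrence =
  fixes \<mu> :: "nat \<Rightarrow> real" and P :: "nat \<Rightarrow> real poly" and b c :: "nat \<Rightarrow> real" and s :: real
  assumes P_0: "P 0 = 1"
    and degree_P: "Polynomial.degree (P j) = j" and monic_P: "lead_coeff (P j) = 1"
    and recurrence: "three_term_recurrence P b c"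
    and c_pos: "c j > 0" and \<mu>_pos: "\<mu> 0 > 0"
    and functional_P: "moment_functional \<mu> (P (Suc j)) = 0"
begin

text \<open>
  The coefficients \<open>c\<close> shifted by one index; the additional value $C_0 = s_0$ makes the sequences \<open>\<Phi>\<close> and \<open>X\<close>
  below satisfy one recurrence from index $0$ on.
\<close>
definition C :: "nat \<Rightarrow> real" where "C m = (case m of 0 \<Rightarrow> \<mu> 0 | Suc i \<Rightarrow> c i)"

text \<open>
  $h_{m+1}$ is the squared norm of $P_m$, see \<open>functional_monom_P_same\<close>.
\<close>
definition h :: "nat \<Rightarrow> real" where "h m = (\<Prod>i<m. C i)"

text \<open>
  $X_{m+1} = \widehat P_m(0)$, written with the functional of $(s_{-1}, s_0, \dots)$: on $P_m$ it takes the
  value $s_{-1}P_m(0) + Q_m(0)$.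
\<close>
definition X :: "nat \<Rightarrow> real" where
  "X m = (case m of 0 \<Rightarrow> - 1 | Suc j \<Rightarrow> moment_functional (case_nat s \<mu>) (P j))"

text \<open>
  Functions of the second kind of \<open>F\<close>, defined by the recurrence, which makes them holomorphic
  wherever \<open>F\<close> is. Their integral representation is proved later.
\<close>
fun \<Phi> :: "(complex \<Rightarrow> complex) \<Rightarrow> nat \<Rightarrow> complex \<Rightarrow> complex" where
  "\<Phi> F 0 z = - 1"
| "\<Phi> F (Suc 0) z = F z"
| "\<Phi> F (Suc (Suc m)) z = (z - of_real (b m)) * \<Phi> F (Suc m) z - of_real (C m) * \<Phi> F m z"

lemma C_pos: "C m > 0"
  by (cases m) (simp_all add: C_def c_pos \<mu>_pos)

lemma h_pos: "h m > 0"
  by (simp add: h_def C_pos prod_pos)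

lemma h_Suc: "h (Suc m) = C m * h m"
  by (simp add: h_def)

lemma pCons_P:
  "pCons 0 (P j) = P (Suc j) + Polynomial.smult (b j) (P j)
     + (case j of 0 \<Rightarrow> 0 | Suc i \<Rightarrow> Polynomial.smult (c i) (P i))"
  using recurrence by (simp add: three_term_recurrence_def)

lemma moment_functional_pCons_P:
  "moment_functional (\<lambda>k. t (Suc k)) (P j) = moment_functional t (P (Suc j)) + b j * moment_functional t (P j)
     + (case j of 0 \<Rightarrow> 0 | Suc i \<Rightarrow> c i * moment_functional t (P i))"
  using arg_cong[OF pCons_P[of j], of "moment_functional t"]
  by (simp add: moment_functional_add moment_functional_smult moment_functional_pCons split: nat.splits)

lemma functional_monom_P:
  "i < m \<Longrightarrow> moment_functional \<mu> (Polynomial.monom 1 i * P m) = 0"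
proof (induction i arbitrary: m)
  case 0
  then show ?case using functional_P[of "m - 1"] by (simp add: monom_0)
next
  case (Suc i)
  then obtain k where m: "m = Suc k" "i < k" by (cases m) auto
  show ?case
    using moment_functional_pCons_P[of "\<lambda>k. \<mu> (i + k)" m] Suc.IH[of m] Suc.IH[of "Suc m"] Suc.IH[of k] m
    by (simp add: moment_functional_monom_mult)
qed

lemma functional_monom_P_same:
  "moment_functional \<mu> (Polynomial.monom 1 m * P m) = h (Suc m)"
proof (induction m)
  case 0
  then show ?case by (simp add: monom_0 P_0 moment_functional_def h_def C_def)
next
  case (Suc m)
  show ?case
    using moment_functional_pCons_P[of "\<lambda>k. \<mu> (m + k)" "Suc m"] Suc
      functional_monom_P[of m "Suc m"] functional_monom_P[of m "Suc (Suc m)"]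
    by (simp add: moment_functional_monom_mult h_Suc C_def)
qed

text \<open>
  Pairing $q$ with $P_d$, where $d$ is the degree of $q$, gives $h_{d+1}$ times the leading coefficient of $q$.
\<close>
lemma eq_0_if_orthogonal:
  assumes "\<And>i. i \<le> Polynomial.degree q \<Longrightarrow> moment_functional \<mu> (Polynomial.monom 1 i * q) = 0"
  shows "q = 0"
proof -
  let ?d = "Polynomial.degree q"
  have "moment_functional \<mu> (P ?d * q) = 0"
    by (subst moment_functional_mult[of _ ?d]) (simp_all add: degree_P assms)
  moreover have "moment_functional \<mu> (q * P ?d) = lead_coeff q * h (Suc ?d)"
    by (subst moment_functional_mult[of _ ?d])
       (simp_all add: lessThan_Suc_atMost[symmetric] functional_monom_P functional_monom_P_same)
  ultimately show ?thesis
    using h_pos[of "Suc ?d"] by (simp add: mult.commute)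
qed

lemma X_recurrence: "X (Suc (Suc m)) = - b m * X (Suc m) - C m * X m"
  using moment_functional_pCons_P[of "case_nat s \<mu>" m] functional_P
  by (cases m) (simp_all add: X_def C_def P_0 moment_functional_def)

lemma X_0: "X 0 = - 1" and X_1: "X (Suc 0) = s"
  by (simp_all add: X_def P_0 moment_functional_def)

lemma X_nonzero: "X m \<noteq> 0 \<or> X (Suc m) \<noteq> 0"
proof (induction m)
  case (Suc m)
  then show ?case using X_recurrence[of m] C_pos[of m] by auto
qed (simp add: X_0)

text \<open>
  Let $q$ have degree less than $n = m + 1$. If the functional of $(s_{-1}, s_0, \dots)$ annihilates $t^iq$
  for $i = 1, \dots, m$, then $q$ is orthogonal to all powers of $t$ below $m$, hence a multiple $wP_m$ of $P_m$.
  The remaining condition, for $i = 0$, is $wX_n = 0$.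
\<close>
lemma normal_iff_X: "n \<in> normal_indices (case_nat s \<mu>) \<longleftrightarrow> 1 \<le> n \<and> X n \<noteq> 0"
proof (cases n)
  case (Suc m)
  let ?M = "moment_functional (case_nat s \<mu>)" and ?S = "moment_functional \<mu>"
  have shift: "?M (Polynomial.monom 1 (Suc i) * q) = ?S (Polynomial.monom 1 i * q)" for i q
    by (simp add: moment_functional_monom_mult)
  have "(\<forall>q. Polynomial.degree q < n \<longrightarrow> (\<forall>i<n. ?M (Polynomial.monom 1 i * q) = 0) \<longrightarrow> q = 0)
     \<longleftrightarrow> X n \<noteq> 0"
  proof
    assume *: "\<forall>q. Polynomial.degree q < n \<longrightarrow> (\<forall>i<n. ?M (Polynomial.monom 1 i * q) = 0) \<longrightarrow> q = 0"
    show "X n \<noteq> 0"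
    proof
      assume X: "X n = 0"
      have "?M (Polynomial.monom 1 i * P m) = 0" if "i < n" for i
      proof (cases i)
        case 0
        then show ?thesis using X by (simp add: Suc X_def monom_0)
      next
        case (Suc i')
        then show ?thesis using that \<open>n = Suc m\<close> by (simp add: shift functional_monom_P)
      qed
      then have "P m = 0" using * by (simp add: degree_P Suc)
      then show False using monic_P[of m] by simp
    qed
  next
    assume X: "X n \<noteq> 0"
    show "\<forall>q. Polynomial.degree q < n \<longrightarrow> (\<forall>i<n. ?M (Polynomial.monom 1 i * q) = 0) \<longrightarrow> q = 0"
    proof (intro allI impI)
      fix q
      assume deg: "Polynomial.degree q < n" and M: "\<forall>i<n. ?M (Polynomial.monom 1 i * q) = 0"
      define r where "r = q - Polynomial.smult (Polynomial.coeff q m) (P m)"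
      have S: "?S (Polynomial.monom 1 i * q) = 0" if "i < m" for i
        using M that shift[of i q] by (auto simp: Suc)
      have "Polynomial.coeff r k = 0" if "k \<ge> m" for k
        using that deg monic_P[of m] by (cases "k = m") (auto simp: r_def Suc degree_P coeff_eq_0)
      then have r: "r = 0 \<or> Polynomial.degree r < m"
        by (metis leading_coeff_0_iff not_le)
      have "r = 0"
      proof (rule ccontr)
        assume "r \<noteq> 0"
        have "?S (Polynomial.monom 1 i * r) = 0" if "i \<le> Polynomial.degree r" for i
        proof -
          have "i < m" using r \<open>r \<noteq> 0\<close> that by simp
          then show ?thesis
            by (simp add: r_def right_diff_distrib moment_functional_diff moment_functional_smult S functional_monom_P)
        qed
        then show False using eq_0_if_orthogonal[of r] \<open>r \<noteq> 0\<close> by blast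
      qed
      then have q: "q = Polynomial.smult (Polynomial.coeff q m) (P m)"
        by (simp add: r_def)
      have "?M q = 0" using M[rule_format, of 0] by (simp add: Suc monom_0)
      then have "Polynomial.coeff q m * X n = 0"
        using arg_cong[OF q, of ?M] by (simp add: Suc X_def moment_functional_smult)
      then show "q = 0" using X q by simp
    qed
  qed
  then show ?thesis by (auto simp: normal_indices_iff Suc)
qed (simp add: normal_indices_def)

text \<open>
  The normal indices of $(s_{-1}, s_0, \dots)$ with $n_0 = 0$.
\<close>
definition n :: "nat \<Rightarrow> nat" where "n = normal_index (case_nat s \<mu>)"

lemma infinite_X_nonzero: "infinite {m. X m \<noteq> 0}"
proof -
  have "\<exists>k\<ge>m. X k \<noteq> 0" for m
    using X_nonzero[of m] by (metis le_refl le_SucI)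
  then show ?thesis by (simp add: infinite_nat_iff_unbounded_le)
qed

text \<open>
  As $X_0 \ne 0$, the convention $n_0 = 0$ needs no separate treatment.
\<close>
lemma n_eq_enumerate: "n j = enumerate {m. X m \<noteq> 0} j"
proof (cases j)
  case 0
  then show ?thesis by (simp add: n_def normal_index_def enumerate_0 X_0 Least_eq_0)
next
  case (Suc i)
  have "(LEAST m. X m \<noteq> 0) = 0" by (simp add: X_0 Least_eq_0)
  moreover have "{m. X m \<noteq> 0} - {0} = normal_indices (case_nat s \<mu>)"
    by (auto simp: normal_iff_X)
  ultimately show ?thesis
    by (simp add: n_def normal_index_def Suc enumerate_Suc)
qed

lemma n_0: "n 0 = 0"
  by (simp add: n_def normal_index_def)

lemma X_n: "X (n j) \<noteq> 0"
  using enumerate_in_set[OF infinite_X_nonzero, of j] by (simp add: n_eq_enumerate)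

lemma n_Suc: "n (Suc j) = (if X (Suc (n j)) = 0 then Suc (Suc (n j)) else Suc (n j))"
proof -
  have "n (Suc j) = (LEAST m. X m \<noteq> 0 \<and> n j < m)"
    by (simp add: n_eq_enumerate enumerate_Suc''[OF infinite_X_nonzero])
  also have "\<dots> = (if X (Suc (n j)) = 0 then Suc (Suc (n j)) else Suc (n j))"
  proof (rule Least_equality)
    show "(if X (Suc (n j)) = 0 then Suc (Suc (n j)) else Suc (n j)) \<le> m" if "X m \<noteq> 0 \<and> n j < m" for m
      using that by (cases "m = Suc (n j)") auto
  qed (use X_nonzero[of "Suc (n j)"] in auto)
  finally show ?thesis .
qed

text \<open>
  The coefficient for which $X_{n_j+1} + a_jX_{n_j} = 0$; it is zero iff the block $j$ has size $2$.
\<close>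
definition a :: "nat \<Rightarrow> real" where "a j = - X (Suc (n j)) / X (n j)"

text \<open>
  The entries $l_j$ of the lower factor. The value $l_0 = X_{n_1}$, which is not an entry of that factor,
  is the first nonzero element of $(s_{-1}, s_0, \dots)$.
\<close>
definition l :: "nat \<Rightarrow> real" where "l j = - X (n (Suc j)) / X (n j)"

text \<open>
  The entries $u_j$ of the upper factor, expressed through the entries of $J$.
\<close>
definition u :: "nat \<Rightarrow> real" where
  "u j = (if n (Suc j) = Suc (n j) then b (n j) - a (Suc j) else c (n j))"

lemma a_eq: "a j = (if n (Suc j) = Suc (n j) then l j else 0)"
  by (simp add: a_def l_def n_Suc)

lemma l_nonzero: "l j \<noteq> 0"
  by (simp add: l_def X_n)

lemma block_size_1:
  assumes "n (Suc j) = Suc (n j)"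
  shows "C (n j) = u j * l j" "a j = l j"
proof -
  have [simp]: "X (Suc (n j)) \<noteq> 0" using X_n[of "Suc j"] assms by simp
  show "a j = l j" using assms by (simp add: a_eq)
  show "C (n j) = u j * l j"
  proof -
    have "C (n j) = - (b (n j) * X (Suc (n j)) + X (Suc (Suc (n j)))) / X (n j)"
      using X_recurrence[of "n j"] X_n[of j] by (simp add: field_simps)
    moreover have "u j * l j = - (b (n j) * X (Suc (n j)) + X (Suc (Suc (n j)))) / X (n j)"
      using assms X_n[of j] by (simp add: u_def a_def l_def field_simps)
    ultimately show ?thesis by simp
  qed
qed

lemma block_size_2:
  assumes "n (Suc j) \<noteq> Suc (n j)"
  shows "n (Suc j) = Suc (Suc (n j))" "C (n j) = l j" "C (Suc (n j)) = u j" "a j = 0"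
    "b (Suc (n j)) = a (Suc j)"
proof -
  have X: "X (Suc (n j)) = 0" using assms n_Suc[of j] by presburger
  then show n: "n (Suc j) = Suc (Suc (n j))" by (simp add: n_Suc)
  show "C (n j) = l j" using X_recurrence[of "n j"] X_n[of j] by (simp add: l_def n X)
  show "C (Suc (n j)) = u j" using assms by (simp add: C_def u_def)
  show "a j = 0" using assms by (simp add: a_eq)
  show "b (Suc (n j)) = a (Suc j)"
    using X_recurrence[of "Suc (n j)"] X_n[of "Suc j"] by (simp add: a_def n X)
qed

lemma h_n_Suc: "h (n (Suc j)) = u j * l j * h (n j)"
  using block_size_1[of j] block_size_2[of j] by (cases "n (Suc j) = Suc (n j)") (simp_all add: h_Suc)

text \<open>
  The Christoffel transform of the sequence \<open>\<Phi>\<close>; up to the factor $X_{n_j}$ it is the Casorati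
  determinant $X_{n_j}\Phi_{n_j+1} - X_{n_j+1}\Phi_{n_j}$.
\<close>
definition T :: "(complex \<Rightarrow> complex) \<Rightarrow> nat \<Rightarrow> complex \<Rightarrow> complex" where
  "T F j z = \<Phi> F (Suc (n j)) z + of_real (a j) * \<Phi> F (n j) z"

text \<open>
  The first of the two first order relations between $T$ and $\Phi$.
\<close>
lemma T_Suc:
  "T F (Suc j) z =
     (if n (Suc j) = Suc (n j) then z - of_real (u j) else z\<^sup>2 - of_real (b (n j)) * z - of_real (u j)) * T F j z
     - of_real (l j) * z * \<Phi> F (n j) z"
proof (cases "n (Suc j) = Suc (n j)")
  case True
  have "of_real (C (n j)) = (of_real (u j) * of_real (l j) :: complex)"
    "of_real (b (n j)) = (of_real (u j) + of_real (a (Suc j)) :: complex)"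
    using True block_size_1[OF True] by (simp_all add: u_def)
  then show ?thesis using True block_size_1[OF True] by (simp add: T_def algebra_simps)
next
  case False
  then show ?thesis using block_size_2[OF False] by (simp add: T_def algebra_simps power2_eq_square)
qed

text \<open>
  The second first order relation; together with the first it eliminates $\Phi$.
\<close>
lemma Phi_n_Suc: "z * \<Phi> F (n (Suc j)) z = T F (Suc j) z + of_real (u j) * T F j z"
proof (cases "n (Suc j) = Suc (n j)")
  case True
  have "of_real (C (n j)) = (of_real (u j) * of_real (l j) :: complex)"
    "of_real (b (n j)) = (of_real (u j) + of_real (a (Suc j)) :: complex)"
    using True block_size_1[OF True] by (simp_all add: u_def)
  then show ?thesis using True block_size_1[OF True] by (simp add: T_def algebra_simps)
next
  case False
  then show ?thesis using block_size_2[OF False] by (simp add: T_def algebra_simps)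
qed

text \<open>
  The polynomials that are read off the diagonal blocks of the product of the lower and the upper
  factor.
\<close>
definition p :: "nat \<Rightarrow> real poly" where
  "p j = (let d = u j + (if j = 0 then 0 else l j)
          in if n (Suc j) = Suc (n j) then [:- d, 1:] else [:- d, - b (n j), 1:])"

lemma cpoly_pCons: "cpoly (pCons r q) z = of_real r + z * cpoly q z"
  by (simp add: map_poly_pCons)

lemma T_recurrence_0: "T F (Suc 0) z = cpoly (p 0) z * T F 0 z + of_real (l 0) * z"
  using T_Suc[of F 0 z] by (simp add: p_def cpoly_pCons n_0 power2_eq_square algebra_simps split: if_splits)

lemma T_recurrence_Suc:
  "T F (Suc (Suc j)) z = cpoly (p (Suc j)) z * T F (Suc j) z - of_real (l (Suc j) * u j) * T F j z"
proof -
  have "of_real (l (Suc j)) * z * \<Phi> F (n (Suc j)) z =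
      of_real (l (Suc j)) * (T F (Suc j) z + of_real (u j) * T F j z)"
    using Phi_n_Suc[of z F j] by (simp add: mult.assoc)
  then show ?thesis
    using T_Suc[of F "Suc j" z]
    by (simp add: p_def cpoly_pCons Let_def power2_eq_square algebra_simps split: if_splits)
qed

end

section \<open>Products of block bidiagonal matrices\<close>

text \<open>
  Block structures all of whose blocks have size $1$ or $2$.
\<close>
locale small_blocks =
  fixes n :: "nat \<Rightarrow> nat"
  assumes n_0: "n 0 = 0" and n_Suc: "n (Suc j) = Suc (n j) \<or> n (Suc j) = Suc (Suc (n j))"
begin

abbreviation k :: "nat \<Rightarrow> nat" where "k \<equiv> block_size n"

lemma block_size_cases: "k j = 1 \<or> k j = 2"
  using n_Suc[of j] by (auto simp: block_size_def)

lemma n_Suc_eq: "n (Suc j) = n j + k j"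
  using n_Suc[of j] by (auto simp: block_size_def)

lemma mono_n: "i \<le> j \<Longrightarrow> n i \<le> n j"
  by (rule lift_Suc_mono_le[of n]) (simp_all add: n_Suc_eq)

lemma block_index_eq:
  assumes "r < k j" shows "block_index n (n j + r) = j"
  unfolding block_index_def
proof (rule Least_equality)
  show "n j + r < n (Suc j)" using assms by (simp add: n_Suc_eq)
  fix i assume "n j + r < n (Suc i)"
  then show "j \<le> i" using mono_n[of "Suc i" j] by (cases "j \<le> i") auto
qed

lemma assemble_blocks_entry:
  "r < k i \<Longrightarrow> t < k j \<Longrightarrow> assemble_blocks n B (n i + r) (n j + t) = B i j $$ (r, t)"
  by (simp add: assemble_blocks_def block_index_eq)

lemma index_cases:
  obtains j r where "i = n j + r" "r < k j"
proof -
  have "\<exists>j r. i = n j + r \<and> r < k j"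
  proof (induction i)
    case 0
    then show ?case using block_size_cases[of 0] by (intro exI[of _ 0]) (auto simp: n_0)
  next
    case (Suc i)
    then obtain j r where i: "i = n j + r" "r < k j" by blast
    show ?case
    proof (cases "Suc r < k j")
      case True
      then show ?thesis using i by (intro exI[of _ j] exI[of _ "Suc r"]) auto
    next
      case False
      then show ?thesis using i block_size_cases[of "Suc j"]
        by (intro exI[of _ "Suc j"] exI[of _ 0]) (auto simp: n_Suc_eq)
    qed
  qed
  then show ?thesis using that by blast
qed

lemma sum_blocks:
  fixes f :: "nat \<Rightarrow> real"
  shows "(\<Sum>m<n M. f m) = (\<Sum>j<M. \<Sum>r<k j. f (n j + r))"
proof (induction M)
  case (Suc M)
  have "(\<Sum>m<n M + K. f m) = (\<Sum>m<n M. f m) + (\<Sum>r<K. f (n M + r))" for K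
    by (induction K) simp_all
  then show ?case using Suc by (simp add: n_Suc_eq)
qed (simp add: n_0)

lemma assemble_blocks_mult:
  assumes r: "r < k i" and t: "t < k j"
    and zero: "\<And>m q. m \<ge> M \<Longrightarrow> q < k m \<Longrightarrow> A i m $$ (r, q) = 0"
  shows "(assemble_blocks n A \<odot> assemble_blocks n B) (n i + r) (n j + t) =
    (\<Sum>m<M. \<Sum>q<k m. A i m $$ (r, q) * B m j $$ (q, t))"
proof -
  let ?f = "\<lambda>m. assemble_blocks n A (n i + r) m * assemble_blocks n B m (n j + t)"
  have "?f m = 0" if "m \<notin> {..<n M}" for m
  proof -
    obtain j' q where m: "m = n j' + q" "q < k j'" by (rule index_cases)
    have "M \<le> j'"
      using that mono_n[of "Suc j'" M] m by (cases "M \<le> j'") (auto simp: n_Suc_eq)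
    then show ?thesis using m by (simp add: assemble_blocks_entry r zero)
  qed
  then have "(assemble_blocks n A \<odot> assemble_blocks n B) (n i + r) (n j + t) = (\<Sum>m<n M. ?f m)"
    unfolding inf_mat_mult_def by (intro suminf_finite) auto
  also have "\<dots> = (\<Sum>m<M. \<Sum>q<k m. A i m $$ (r, q) * B m j $$ (q, t))"
    unfolding sum_blocks by (intro sum.cong) (auto simp: assemble_blocks_entry r t)
  finally show ?thesis .
qed

definition U_block :: "(nat \<Rightarrow> real) \<Rightarrow> nat \<Rightarrow> nat \<Rightarrow> real Matrix.mat" where
  "U_block u i j = (if j = i then
       (if k i = 1 then mat_of_rows_list 1 [[u i]] else mat_of_rows_list 2 [[0, 1], [u i, 0]])
     else if j = Suc i then lower_left (k i) (k j) 1
     else 0\<^sub>m (k i) (k j))"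

definition L_block :: "(nat \<Rightarrow> real) \<Rightarrow> (nat \<Rightarrow> real) \<Rightarrow> nat \<Rightarrow> nat \<Rightarrow> real Matrix.mat" where
  "L_block e l i j = (if j = i then
       (if k i = 1 then mat_of_rows_list 1 [[1]] else mat_of_rows_list 2 [[1, 0], [e i, 1]])
     else if i = Suc j then lower_right (k i) (k j) (l i)
     else 0\<^sub>m (k i) (k j))"

lemma lower_left_entry:
  "r < M \<Longrightarrow> t < N \<Longrightarrow> lower_left M N v $$ (r, t) = (if r = M - 1 \<and> t = 0 then v else 0)"
  by (simp add: lower_left_def)

lemma U_factor_eq: "U_factor n u = assemble_blocks n (U_block u)"
  by (simp add: U_factor_def U_block_def[abs_def] Let_def)

lemma L_factor_eq: "L_factor n e l = assemble_blocks n (L_block e l)"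
  by (simp add: L_factor_def L_block_def[abs_def] Let_def)

lemma U_block_entry:
  assumes "r < k i" "t < k j"
  shows "U_block u i j $$ (r, t) =
    (if j = i then (if k i = 1 then u i else if r = 0 then (if t = 0 then 0 else 1) else (if t = 0 then u i else 0))
     else if j = Suc i then (if r = k i - 1 \<and> t = 0 then 1 else 0) else 0)"
  using assms block_size_cases[of i]
  by (auto simp: U_block_def lower_left_def mat_of_rows_list_def less_Suc_eq numeral_2_eq_2)

lemma L_block_entry:
  assumes "r < k i" "t < k j"
  shows "L_block e l i j $$ (r, t) =
    (if j = i then (if r = t then 1 else if r = 0 then 0 else e i)
     else if i = Suc j then (if r = k i - 1 \<and> t = k j - 1 then l i else 0) else 0)"
  using assms block_size_cases[of i]
  by (auto simp: L_block_def lower_right_def mat_of_rows_list_def less_Suc_eq numeral_2_eq_2)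

lemma UL_entry:
  assumes r: "r < k i" and t: "t < k j"
  shows "(U_factor n u \<odot> L_factor n e l) (n i + r) (n j + t) =
    (\<Sum>q<k i. U_block u i i $$ (r, q) * L_block e l i j $$ (q, t))
    + (if r = k i - 1 then L_block e l (Suc i) j $$ (0, t) else 0)"
proof -
  have "(U_factor n u \<odot> L_factor n e l) (n i + r) (n j + t) =
    (\<Sum>m<Suc (Suc i). \<Sum>q<k m. U_block u i m $$ (r, q) * L_block e l m j $$ (q, t))"
    unfolding U_factor_eq L_factor_eq
    by (rule assemble_blocks_mult[OF r t]) (simp add: U_block_entry[OF r])
  moreover have "(\<Sum>q<k m. U_block u i m $$ (r, q) * L_block e l m j $$ (q, t)) = 0" if "m < i" for m
    using that by (intro sum.neutral) (simp add: U_block_entry[OF r])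
  moreover have "(\<Sum>q<k (Suc i). U_block u i (Suc i) $$ (r, q) * L_block e l (Suc i) j $$ (q, t)) =
     (if r = k i - 1 then L_block e l (Suc i) j $$ (0, t) else 0)"
  proof -
    have "U_block u i (Suc i) $$ (r, q) * L_block e l (Suc i) j $$ (q, t) =
        (if q = 0 then if r = k i - 1 then L_block e l (Suc i) j $$ (0, t) else 0 else 0)"
      if "q < k (Suc i)" for q
      unfolding U_block_entry[OF r that] by simp
    then show ?thesis using block_size_cases[of "Suc i"] by (auto simp: sum.delta)
  qed
  ultimately show ?thesis by simp
qed

lemma LU_entry:
  assumes r: "r < k i" and t: "t < k j"
  shows "(L_factor n e l \<odot> U_factor n u) (n i + r) (n j + t) =
    U_block u i j $$ (r, t) + (if r = 0 then 0 else e i * U_block u i j $$ (0, t))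
    + (case i of 0 \<Rightarrow> 0 | Suc i' \<Rightarrow> if r = k i - 1 then l i * U_block u i' j $$ (k i' - 1, t) else 0)"
proof -
  have "(L_factor n e l \<odot> U_factor n u) (n i + r) (n j + t) =
    (\<Sum>m<Suc i. \<Sum>q<k m. L_block e l i m $$ (r, q) * U_block u m j $$ (q, t))"
    unfolding U_factor_eq L_factor_eq
    by (rule assemble_blocks_mult[OF r t]) (simp add: L_block_entry[OF r])
  moreover have "(\<Sum>m<i. \<Sum>q<k m. L_block e l i m $$ (r, q) * U_block u m j $$ (q, t)) =
    (case i of 0 \<Rightarrow> 0 | Suc i' \<Rightarrow> if r = k i - 1 then l i * U_block u i' j $$ (k i' - 1, t) else 0)"
  proof (cases i)
    case (Suc i')
    have "(\<Sum>q<k m. L_block e l i m $$ (r, q) * U_block u m j $$ (q, t)) = 0" if "m < i'" for m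
      using that r by (intro sum.neutral) (simp add: L_block_entry Suc)
    moreover have "(\<Sum>q<k i'. L_block e l i i' $$ (r, q) * U_block u i' j $$ (q, t)) =
       (if r = k i - 1 then l i * U_block u i' j $$ (k i' - 1, t) else 0)"
    proof -
      have "L_block e l i i' $$ (r, q) * U_block u i' j $$ (q, t) =
          (if q = k i' - 1 then if r = k i - 1 then l i * U_block u i' j $$ (k i' - 1, t) else 0 else 0)"
        if "q < k i'" for q
        unfolding L_block_entry[OF r that] by (simp add: Suc)
      then show ?thesis using block_size_cases[of i'] by (auto simp: sum.delta)
    qed
    ultimately show ?thesis by (simp add: Suc)
  qed simp
  moreover have "(\<Sum>q<k i. L_block e l i i $$ (r, q) * U_block u i j $$ (q, t)) =
    U_block u i j $$ (r, t) + (if r = 0 then 0 else e i * U_block u i j $$ (0, t))"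
    using block_size_cases[of i] r
    by (elim disjE) (auto simp: L_block_entry numeral_2_eq_2 less_Suc_eq)
  ultimately show ?thesis by simp
qed

lemma UL_block_size_1:
  assumes "k j = 1"
  shows "(U_factor n u \<odot> L_factor n e l) (n j) (n j) = u j + (if k (Suc j) = 1 then l (Suc j) else 0)"
  using UL_entry[of 0 j 0 j u e l] assms block_size_cases[of "Suc j"]
  by (auto simp: U_block_entry L_block_entry)

lemma UL_block_size_2:
  assumes "k j = 2"
  shows "(U_factor n u \<odot> L_factor n e l) (n j) (n j) = e j"
    and "(U_factor n u \<odot> L_factor n e l) (Suc (n j)) (n j) = u j"
  using UL_entry[of 0 j 0 j u e l] UL_entry[of 1 j 0 j u e l] assms block_size_cases[of "Suc j"]
  by (auto simp: U_block_entry L_block_entry numeral_2_eq_2)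

text \<open>
  The product of a block lower and a block upper bidiagonal factor is block tridiagonal. The
  diagonal block is the product of the diagonal blocks with $l_j$ added in the lower left corner, for $j \ge 1$, and the
  subdiagonal block has the single entry $l_{j+1}u_j$.
\<close>
lemma LU_eq_generalized_jacobi:
  assumes p0: "\<And>j. Polynomial.coeff (p j) 0 = - (u j + (if j = 0 then 0 else l j))"
    and p1: "\<And>j. k j = 2 \<Longrightarrow> Polynomial.coeff (p j) 1 = - e j"
    and c: "\<And>j. c j = l (Suc j) * u j"
  shows "L_factor n e l \<odot> U_factor n u = generalized_jacobi n p c"
proof (intro ext)
  fix x y
  obtain i r where x: "x = n i + r" "r < k i" by (rule index_cases)
  obtain j t where y: "y = n j + t" "t < k j" by (rule index_cases)
  have r: "r = 0 \<or> r = 1" using x(2) block_size_cases[of i] by linarith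
  have t: "t = 0 \<or> t = 1" using y(2) block_size_cases[of j] by linarith
  have pos: "0 < k m" for m using block_size_cases[of m] by auto
  have "generalized_jacobi n p c x y =
    (if j = i then
       (if k i = 1 then u i + (if i = 0 then 0 else l i)
        else if r = 0 then (if t = 0 then 0 else 1)
        else if t = 0 then u i + (if i = 0 then 0 else l i) else e i)
     else if j = Suc i then (if r = k i - 1 \<and> t = 0 then 1 else 0)
     else if i = Suc j then (if r = k i - 1 \<and> t = 0 then c j else 0)
     else 0)"
    unfolding generalized_jacobi_def Let_def x y assemble_blocks_entry[OF x(2) y(2)]
    using x(2) y(2) r t block_size_cases[of i] p1[of i]
    by (elim disjE) (auto simp: lower_left_entry mat_of_rows_list_def p0)
  also have "\<dots> = (L_factor n e l \<odot> U_factor n u) x y"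
  proof (cases i)
    case 0
    then show ?thesis
      unfolding x(1) y(1) LU_entry[OF x(2) y(2)] U_block_entry[OF x(2) y(2)] U_block_entry[OF pos y(2)]
      using x(2) r block_size_cases[of i] by auto
  next
    case (Suc i')
    have last: "k i' - 1 < k i'" using pos[of i'] by simp
    have LU: "(L_factor n e l \<odot> U_factor n u) x y =
      U_block u i j $$ (r, t) + (if r = 0 then 0 else e i * U_block u i j $$ (0, t))
        + (if r = k i - 1 then l i * U_block u i' j $$ (k i' - 1, t) else 0)"
      unfolding x(1) y(1) LU_entry[OF x(2) y(2)] using Suc by simp
    note entries = U_block_entry[OF x(2) y(2)] U_block_entry[OF pos y(2)] U_block_entry[OF last y(2)]
    consider "j = i" | "j = Suc i" | "j = i'" | "j \<noteq> i" "j \<noteq> Suc i" "j \<noteq> i'" by blast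
    then show ?thesis
    proof cases
      case 1
      then show ?thesis
        using x(2) y(2) r t block_size_cases[of i] unfolding LU entries
        by (elim disjE) (simp_all add: Suc)
    next
      case 2
      then show ?thesis
        using x(2) r block_size_cases[of i] unfolding LU entries
        by (elim disjE) (simp_all add: Suc)
    next
      case 3
      then show ?thesis
        using y(2) t block_size_cases[of i'] unfolding LU entries
        by (elim disjE) (simp_all add: Suc c)
    next
      case 4
      then show ?thesis
        unfolding LU entries by (simp add: Suc)
    qed
  qed
  finally show "(L_factor n e l \<odot> U_factor n u) x y = generalized_jacobi n p c x y" ..
qed

end

section \<open>Cauchy transforms\<close>

text \<open>
  $\int q(t)/(t-z)\,d\sigma(t)$.
\<close>
definition cauchy_transform :: "real measure \<Rightarrow> real poly \<Rightarrow> complex \<Rightarrow> complex" where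
  "cauchy_transform \<sigma> q z = (\<integral>t. of_real (poly q t) / (of_real t - z) \<partial>\<sigma>)"

context
  fixes \<sigma> :: "real measure" and F :: "complex \<Rightarrow> complex"
  assumes represents: "represents \<sigma> F"
begin

lemma integrable_poly: "integrable \<sigma> (poly q)"
proof -
  have "integrable \<sigma> (\<lambda>t. \<Sum>i\<le>Polynomial.degree q. Polynomial.coeff q i * t ^ i)"
    using represents by (intro Bochner_Integration.integrable_sum integrable_mult_right) (auto simp: represents_def)
  then show ?thesis by (simp add: poly_altdef[abs_def])
qed

lemma integral_poly: "(\<integral>t. poly q t \<partial>\<sigma>) = moment_functional (moment \<sigma>) q"
  using represents
  by (simp add: poly_altdef moment_functional_def moment_def represents_def)

lemma norm_cauchy_kernel_le:
  assumes "z \<in> upper_hp"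
  shows "norm (of_real (poly q t) / (of_real t - z)) \<le> \<bar>poly q t\<bar> / Im z"
proof -
  have "Im z \<le> norm (of_real t - z)"
    using abs_Im_le_cmod[of "of_real t - z"] assms by (simp add: upper_hp_def)
  then show ?thesis
    using assms by (simp add: norm_divide upper_hp_def frac_le)
qed

lemma integrable_cauchy_kernel:
  assumes "z \<in> upper_hp"
  shows "integrable \<sigma> (\<lambda>t. of_real (poly q t) / (of_real t - z))"
proof (rule Bochner_Integration.integrable_bound)
  show "integrable \<sigma> (\<lambda>t. poly q t / Im z)"
    by (intro integrable_divide integrable_poly)
  have "of_real t - z \<noteq> 0" for t
    using assms by (auto simp: upper_hp_def)
  then have "(\<lambda>t. of_real (poly q t) / (of_real t - z)) \<in> borel_measurable borel"
    by (intro borel_measurable_continuous_onI continuous_intros) auto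
  moreover have "sets \<sigma> = sets borel" using represents by (simp add: represents_def)
  ultimately show "(\<lambda>t. of_real (poly q t) / (of_real t - z)) \<in> borel_measurable \<sigma>"
    by (simp cong: measurable_cong_sets)
  show "AE t in \<sigma>. norm (of_real (poly q t) / (of_real t - z)) \<le> norm (poly q t / Im z)"
    using norm_cauchy_kernel_le[OF assms, of q] assms by (auto simp: upper_hp_def)
qed

lemma norm_cauchy_transform_le:
  assumes "z \<in> upper_hp"
  shows "norm (cauchy_transform \<sigma> q z) \<le> (\<integral>t. \<bar>poly q t\<bar> \<partial>\<sigma>) / Im z"
proof -
  have "norm (cauchy_transform \<sigma> q z) \<le> (\<integral>t. \<bar>poly q t\<bar> / Im z \<partial>\<sigma>)"
    unfolding cauchy_transform_def
    by (rule Bochner_Integration.integral_norm_bound_integral)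
       (intro integrable_cauchy_kernel assms integrable_divide integrable_abs integrable_poly norm_cauchy_kernel_le)+
  then show ?thesis by simp
qed

lemma cauchy_transform_pCons:
  assumes "z \<in> upper_hp"
  shows "z * cauchy_transform \<sigma> q z = cauchy_transform \<sigma> (pCons 0 q) z - of_real (moment_functional (moment \<sigma>) q)"
proof -
  have "of_real t - z \<noteq> 0" for t
    using assms by (auto simp: upper_hp_def)
  moreover have "of_real (poly (pCons 0 q) t) / (of_real t - z) - z * (of_real (poly q t) / (of_real t - z))
      = (of_real t - z) * (of_real (poly q t) / (of_real t - z))" for t
    by (simp add: left_diff_distrib diff_divide_distrib)
  ultimately have "of_real (poly (pCons 0 q) t) / (of_real t - z) - z * (of_real (poly q t) / (of_real t - z)) = of_real (poly q t)" for t
    by simp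
  moreover have "cauchy_transform \<sigma> (pCons 0 q) z - z * cauchy_transform \<sigma> q z =
     (\<integral>t. of_real (poly (pCons 0 q) t) / (of_real t - z) - z * (of_real (poly q t) / (of_real t - z)) \<partial>\<sigma>)"
    unfolding cauchy_transform_def
    by (subst Bochner_Integration.integral_diff) (use integrable_cauchy_kernel[OF assms] in \<open>auto simp del: poly_pCons times_divide_eq_right\<close>)
  ultimately have "cauchy_transform \<sigma> (pCons 0 q) z - z * cauchy_transform \<sigma> q z = of_real (moment_functional (moment \<sigma>) q)"
    by (simp only: integral_complex_of_real integral_poly)
  then show ?thesis by (simp add: algebra_simps)
qed

lemma cauchy_transform_add:
  "z \<in> upper_hp \<Longrightarrow> cauchy_transform \<sigma> (q + r) z = cauchy_transform \<sigma> q z + cauchy_transform \<sigma> r z"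
  unfolding cauchy_transform_def
  by (subst Bochner_Integration.integral_add[symmetric]) (auto intro: integrable_cauchy_kernel simp: add_divide_distrib)

lemma cauchy_transform_smult:
  "cauchy_transform \<sigma> (Polynomial.smult w q) z = of_real w * cauchy_transform \<sigma> q z"
  by (simp add: cauchy_transform_def mult.assoc flip: times_divide_eq_right)

lemma cauchy_transform_1: "z \<in> upper_hp \<Longrightarrow> cauchy_transform \<sigma> 1 z = F z"
  using represents by (simp add: represents_def cauchy_transform_def)

text \<open>
  Expansion of $1/(t-z)$ in powers of $t/z$, with the remainder $(t/z)^N/(t-z)$ integrated against $q$.
\<close>
lemma cauchy_transform_expansion_eq:
  assumes "z \<in> upper_hp"
  shows "cauchy_transform \<sigma> q z = - (\<Sum>i<N. of_real (moment_functional (moment \<sigma>) (Polynomial.monom 1 i * q)) / z ^ Suc i)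
     + cauchy_transform \<sigma> (Polynomial.monom 1 N * q) z / z ^ N"
proof (induction N)
  case 0
  then show ?case by (simp add: monom_0)
next
  case (Suc N)
  have "z \<noteq> 0" using assms by (auto simp: upper_hp_def)
  let ?q = "Polynomial.monom 1 N * q"
  have "cauchy_transform \<sigma> ?q z / z ^ N = z * cauchy_transform \<sigma> ?q z / z ^ Suc N"
    using \<open>z \<noteq> 0\<close> by simp
  also have "\<dots> = cauchy_transform \<sigma> (pCons 0 ?q) z / z ^ Suc N
      - of_real (moment_functional (moment \<sigma>) ?q) / z ^ Suc N"
    unfolding cauchy_transform_pCons[OF assms] by (simp only: diff_divide_distrib)
  finally show ?case
    using Suc by (simp add: monom_Suc)
qed

lemma expands_cauchy_transform:
  assumes "\<theta> > 0"
  shows "expands (sector_at_infinity \<theta>) (cauchy_transform \<sigma> q)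
    (Abs_fps (\<lambda>i. case i of 0 \<Rightarrow> 0 | Suc j \<Rightarrow> - moment_functional (moment \<sigma>) (Polynomial.monom 1 j * q)))"
    (is "expands ?S _ ?A")
  unfolding expands_def
proof
  fix N
  have bounded: "cauchy_transform \<sigma> r \<in> O[?S](\<lambda>_. 1)" for r
  proof (rule bigoI)
    have "eventually (\<lambda>z::complex. 1 \<le> norm z) ?S"
      by (rule filter_leD[OF sector_le_at_infinity]) (auto simp: eventually_at_infinity)
    with eventually_sector_Im[OF assms]
    show "eventually (\<lambda>z. norm (cauchy_transform \<sigma> r z) \<le> (\<integral>t. \<bar>poly r t\<bar> \<partial>\<sigma>) / sin \<theta> * norm (1::complex)) ?S"
    proof eventually_elim
      case (elim z)
      have "sin \<theta> \<le> norm z * sin \<theta>" using elim by simp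
      also have "\<dots> \<le> Im z" using elim by simp
      finally have "sin \<theta> \<le> Im z" .
      then have "(\<integral>t. \<bar>poly r t\<bar> \<partial>\<sigma>) / Im z \<le> (\<integral>t. \<bar>poly r t\<bar> \<partial>\<sigma>) / sin \<theta>"
        using elim by (intro divide_left_mono) (auto simp: upper_hp_def)
      then show ?case using norm_cauchy_transform_le[of z r] elim by simp
    qed
  qed
  have sum_eq: "(\<Sum>i<Suc N. of_real (fps_nth ?A i) / z ^ i) =
     - (\<Sum>i<N. of_real (moment_functional (moment \<sigma>) (Polynomial.monom 1 i * q)) / z ^ Suc i)" for z :: complex
    by (subst sum.lessThan_Suc_shift) (simp add: sum_negf)
  have "(\<lambda>z. cauchy_transform \<sigma> (Polynomial.monom 1 N * q) z + of_real (fps_nth ?A N)) \<in> O[?S](\<lambda>_. 1)"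
    by (intro sum_in_bigo bounded) simp
  from landau_o.big.mult_right[OF this, of "\<lambda>z. 1 / z ^ N"]
  have *: "(\<lambda>z. (cauchy_transform \<sigma> (Polynomial.monom 1 N * q) z + of_real (fps_nth ?A N)) * (1 / z ^ N)) \<in> O[?S](\<lambda>z. 1 / z ^ N)"
    by simp
  have "eventually (\<lambda>z. (cauchy_transform \<sigma> (Polynomial.monom 1 N * q) z + of_real (fps_nth ?A N)) * (1 / z ^ N)
      = cauchy_transform \<sigma> q z - (\<Sum>i<N. of_real (fps_nth ?A i) / z ^ i)) ?S"
    using eventually_sector_Im[OF assms]
  proof eventually_elim
    case (elim z)
    have arith: "w + v = y - x1" if "x1 + v = x2" "y = x2 + w" for x1 x2 v w y :: complex
      using that by (simp add: algebra_simps)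
    have 1: "(\<Sum>i<N. of_real (fps_nth ?A i) / z ^ i) + of_real (fps_nth ?A N) / z ^ N =
      - (\<Sum>i<N. of_real (moment_functional (moment \<sigma>) (Polynomial.monom 1 i * q)) / z ^ Suc i)"
      using sum_eq[of z] by simp
    have 2: "cauchy_transform \<sigma> q z = - (\<Sum>i<N. of_real (moment_functional (moment \<sigma>) (Polynomial.monom 1 i * q)) / z ^ Suc i)
     + cauchy_transform \<sigma> (Polynomial.monom 1 N * q) z / z ^ N"
      using elim by (intro cauchy_transform_expansion_eq) simp
    from arith[OF 1 2] show ?case
      by (simp only: add_divide_distrib times_divide_eq_right mult_1_right)
  qed
  from landau_o.big.in_cong[OF this] *
  show "(\<lambda>z. cauchy_transform \<sigma> q z - (\<Sum>i<N. of_real (fps_nth ?A i) / z ^ i)) \<in> O[?S](\<lambda>z. 1 / z ^ N)"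
    by (rule iffD1)
qed

end

lemma second_kind_eq:
  assumes "represents \<sigma> F" "P j = pCons a q"
  shows "second_kind \<sigma> P j 0 = moment_functional (moment \<sigma>) q"
proof -
  have "(if t = 0 then poly (pderiv (P j)) 0 else (poly (P j) 0 - poly (P j) t) / (0 - t)) = poly q t" for t
    by (simp add: assms(2) pderiv_pCons)
  then show ?thesis
    using integral_poly[OF assms(1), of q] by (simp add: second_kind_def cong: if_cong)
qed

section \<open>The continued fraction\<close>

lemma open_upper_hp: "open upper_hp" and connected_upper_hp: "connected upper_hp"
  unfolding upper_hp_def
  by (simp_all add: open_halfspace_Im_gt convex_halfspace_Im_gt convex_connected)

lemma upper_hp_nonzero: "z \<in> upper_hp \<Longrightarrow> z \<noteq> 0"
  by (auto simp: upper_hp_def)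

lemma sector_ne_bot: "sector_at_infinity 1 \<noteq> bot"
proof -
  have "\<exists>z. norm z \<ge> r \<and> 1 < Arg z \<and> Arg z < pi - 1" for r
  proof (intro exI[of _ "of_real (max r 1) * \<i>"] conjI)
    have "Arg (of_real (max r 1) * \<i>) = Arg \<i>"
      by (rule Arg_times_of_real) simp
    then show "1 < Arg (of_real (max r 1) * \<i>)" "Arg (of_real (max r 1) * \<i>) < pi - 1"
      using pi_gt3 by (simp_all add: Arg_ii)
  qed (simp add: norm_mult)
  then show ?thesis
    by (auto simp: sector_at_infinity_def trivial_limit_def eventually_inf_principal eventually_at_infinity)
qed

text \<open>
  The recurrence of the orthogonal polynomials of \<open>\<sigma>\<close>, together with the function \<open>F\<close> represented by \<open>\<sigma>\<close>.
\<close>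
locale jacobi_function = orthogonal_recurrence "moment \<sigma>" P b c s
  for \<sigma> :: "real measure" and P b c s +
  fixes F :: "complex \<Rightarrow> complex"
  assumes represents: "represents \<sigma> F" and F_holomorphic: "F holomorphic_on upper_hp"
begin

lemma \<Phi>_eq_cauchy_transform:
  assumes z: "z \<in> upper_hp"
  shows "\<Phi> F (Suc m) z = cauchy_transform \<sigma> (P m) z"
proof (induction m rule: less_induct)
  case (less m)
  note ct = cauchy_transform_add[OF represents z] cauchy_transform_smult[OF represents]
    cauchy_transform_pCons[OF represents z]
  show ?case
  proof (cases m)
    case 0
    then show ?thesis by (simp add: P_0 cauchy_transform_1[OF represents z])
  next
    case (Suc k)
    have "z * cauchy_transform \<sigma> (P k) z = cauchy_transform \<sigma> (P (Suc k)) z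
        + of_real (b k) * cauchy_transform \<sigma> (P k) z + of_real (C k) * \<Phi> F k z"
    proof (cases k)
      case 0
      have "moment_functional (moment \<sigma>) 1 = moment \<sigma> 0" by (simp add: moment_functional_def)
      then show ?thesis
        using arg_cong[OF pCons_P[of 0], of "\<lambda>q. cauchy_transform \<sigma> q z"] ct(2)[of "b 0" 1 z] 0
        by (simp add: ct P_0 C_def)
    next
      case (Suc i)
      then show ?thesis
        using arg_cong[OF pCons_P[of k], of "\<lambda>q. cauchy_transform \<sigma> q z"] functional_P[of i] less[of i] \<open>m = Suc k\<close>
        by (simp add: ct C_def)
    qed
    then show ?thesis
      using less[of k] Suc by (simp add: algebra_simps)
  qed
qed

lemma power_mult_cauchy_transform:
  assumes z: "z \<in> upper_hp" and "i \<le> m"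
  shows "z ^ i * cauchy_transform \<sigma> (P m) z = cauchy_transform \<sigma> (Polynomial.monom 1 i * P m) z"
  using \<open>i \<le> m\<close>
proof (induction i)
  case 0
  then show ?case by (simp add: monom_0)
next
  case (Suc i)
  then show ?case
    using cauchy_transform_pCons[OF represents z, of "Polynomial.monom 1 i * P m"] functional_monom_P[of i m]
    by (simp add: monom_Suc mult.assoc)
qed

text \<open>
  Orthogonality removes all terms of the expansion of $\Phi_m$ up to $z^{-m+1}$; the coefficient
  of $z^{-m}$ is the negative of the squared norm of $P_{m-1}$.
\<close>
lemma expands_\<Phi>:
  "\<exists>A. fps_nth A 0 = - h m \<and> (\<forall>\<theta>>0. expands (sector_at_infinity \<theta>) (\<lambda>z. z ^ m * \<Phi> F m z) A)"
proof (cases m)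
  case 0
  have "expands (sector_at_infinity \<theta>) (\<lambda>z. z ^ m * \<Phi> F m z) (fps_const (- 1))" for \<theta>
    using expands_const[OF sector_le_at_infinity, of \<theta> "-1"] by (simp add: 0)
  then show ?thesis by (intro exI[of _ "fps_const (- 1)"]) (simp add: h_def 0)
next
  case (Suc k)
  let ?q = "Polynomial.monom 1 (Suc k) * P k"
  define A where "A = Abs_fps (\<lambda>i. case i of 0 \<Rightarrow> 0 | Suc j \<Rightarrow> - moment_functional (moment \<sigma>) (Polynomial.monom 1 j * ?q))"
  have "expands (sector_at_infinity \<theta>) (\<lambda>z. z ^ m * \<Phi> F m z) (A - fps_const (h m))" if "\<theta> > 0" for \<theta>
  proof (rule expands_cong)
    show "expands (sector_at_infinity \<theta>) (\<lambda>z. cauchy_transform \<sigma> ?q z - of_real (h m)) (A - fps_const (h m))"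
      unfolding A_def
      by (intro expands_diff expands_cauchy_transform[OF represents] expands_const sector_le_at_infinity that)
    show "\<forall>\<^sub>F z in sector_at_infinity \<theta>. cauchy_transform \<sigma> ?q z - of_real (h m) = z ^ m * \<Phi> F m z"
      using eventually_sector_Im[OF that]
    proof eventually_elim
      case (elim z)
      then have z: "z \<in> upper_hp" by simp
      have "z ^ m * \<Phi> F m z = z * (z ^ k * cauchy_transform \<sigma> (P k) z)"
        by (simp add: Suc \<Phi>_eq_cauchy_transform[OF z])
      also have "\<dots> = cauchy_transform \<sigma> ?q z - of_real (h m)"
        unfolding power_mult_cauchy_transform[OF z order.refl] cauchy_transform_pCons[OF represents z]
        by (simp add: monom_Suc functional_monom_P_same Suc)
      finally show ?case ..
    qed
  qed
  then show ?thesis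
    by (intro exI[of _ "A - fps_const (h m)"]) (simp add: A_def)
qed

lemma holomorphic_\<Phi>: "\<Phi> F m holomorphic_on upper_hp"
proof (induction m rule: less_induct)
  case (less m)
  consider "m = 0" | "m = Suc 0" | k where "m = Suc (Suc k)" by (metis not0_implies_Suc)
  then show ?case
  proof cases
    case 3
    have "(\<lambda>z. (z - of_real (b k)) * \<Phi> F (Suc k) z - of_real (C k) * \<Phi> F k z) holomorphic_on upper_hp"
      using less[of k] less[of "Suc k"] 3 by (intro holomorphic_intros) auto
    then show ?thesis using 3 by (simp add: fun_eq_iff cong: holomorphic_cong)
  qed (use F_holomorphic in \<open>simp_all cong: holomorphic_cong\<close>)
qed

text \<open>
  The limit of $z^{n_{j+1}-1}T_j(z)$ as $z$ tends to infinity in a sector, for both block sizes.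
\<close>
definition r :: "nat \<Rightarrow> real" where "r j = - l j * h (n j)"

lemma r_nonzero: "r j \<noteq> 0"
  using l_nonzero[of j] h_pos[of "n j"] by (simp add: r_def)

lemma r_ratio: "r (Suc j) / r j = l (Suc j) * u j"
  using l_nonzero[of j] h_pos[of "n j"] by (simp add: r_def h_n_Suc)

text \<open>
  $V_{j+1} = T_j/(r_jz)$, which behaves like $z^{-n_{j+1}}$, and $V_0 = 1$.
\<close>
fun V :: "nat \<Rightarrow> complex \<Rightarrow> complex" where
  "V 0 z = 1"
| "V (Suc j) z = T F j z / (of_real (r j) * z)"

lemma V_recurrence:
  assumes "z \<noteq> 0"
  shows "of_real (r (Suc j) / r j) * V (Suc (Suc j)) z = cpoly (p j) z * V (Suc j) z - V j z"
proof (cases j)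
  case 0
  have "r 0 = - l 0" by (simp add: r_def n_0 h_def)
  then show ?thesis
    using assms r_nonzero[of 0] r_nonzero[of "Suc 0"] T_recurrence_0[of F z]
    by (simp add: 0 field_simps)
next
  case (Suc i)
  show ?thesis
    using assms r_nonzero[of i] r_nonzero[of "Suc i"] r_nonzero[of "Suc (Suc i)"]
      T_recurrence_Suc[of F i z, folded r_ratio]
    by (simp add: Suc field_simps)
qed

lemma holomorphic_V: "V j holomorphic_on upper_hp"
proof (cases j)
  case (Suc i)
  have "(\<lambda>z. (\<Phi> F (Suc (n i)) z + of_real (a i) * \<Phi> F (n i) z) / (of_real (r i) * z)) holomorphic_on upper_hp"
    by (intro holomorphic_intros holomorphic_\<Phi>) (auto simp: r_nonzero upper_hp_nonzero)
  then show ?thesis by (simp add: Suc T_def cong: holomorphic_cong)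
qed (simp cong: holomorphic_cong)

lemma expands_V:
  "\<exists>A. fps_nth A 0 = 1 \<and> (\<forall>\<theta>>0. expands (sector_at_infinity \<theta>) (\<lambda>z. z ^ n j * V j z) A)"
proof (cases j)
  case 0
  then show ?thesis
    using expands_const[OF sector_le_at_infinity, of _ 1]
    by (intro exI[of _ "fps_const 1"]) (simp add: n_0)
next
  case (Suc i)
  obtain A where A: "fps_nth A 0 = - h (Suc (n i))"
    "\<And>\<theta>. \<theta> > 0 \<Longrightarrow> expands (sector_at_infinity \<theta>) (\<lambda>z. z ^ Suc (n i) * \<Phi> F (Suc (n i)) z) A"
    using expands_\<Phi> by blast
  obtain B where B: "fps_nth B 0 = - h (n i)"
    "\<And>\<theta>. \<theta> > 0 \<Longrightarrow> expands (sector_at_infinity \<theta>) (\<lambda>z. z ^ n i * \<Phi> F (n i) z) B"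
    using expands_\<Phi> by blast
  have nz: "eventually (\<lambda>z. z \<noteq> 0) (sector_at_infinity \<theta>)" for \<theta>
    using eventually_sector by eventually_elim simp
  show ?thesis
  proof (cases "n (Suc i) = Suc (n i)")
    case True
    let ?A = "fps_const (1 / r i) * (fps_const (a i) * B - fps_const (- 1) * (fps_X ^ 1 * A))"
    have "expands (sector_at_infinity \<theta>) (\<lambda>z. z ^ n j * V j z) ?A" if "\<theta> > 0" for \<theta>
    proof (rule expands_cong)
      show "expands (sector_at_infinity \<theta>) (\<lambda>z. of_real (1 / r i) * (of_real (a i) * (z ^ n i * \<Phi> F (n i) z)
          - of_real (- 1) * (1 / z ^ 1 * (z ^ Suc (n i) * \<Phi> F (Suc (n i)) z)))) ?A"
        by (intro expands_mult expands_diff expands_const expands_inverse_power A B that sector_le_at_infinity)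
      show "\<forall>\<^sub>F z in sector_at_infinity \<theta>. of_real (1 / r i) * (of_real (a i) * (z ^ n i * \<Phi> F (n i) z)
          - of_real (- 1) * (1 / z ^ 1 * (z ^ Suc (n i) * \<Phi> F (Suc (n i)) z))) = z ^ n j * V j z"
        using nz by eventually_elim (simp add: Suc True T_def r_nonzero field_simps)
    qed
    moreover have "fps_nth ?A 0 = 1"
      using block_size_1[OF True] B(1) r_nonzero[of i] by (simp add: r_def)
    ultimately show ?thesis by blast
  next
    case False
    let ?A = "fps_const (1 / r i) * A"
    have "expands (sector_at_infinity \<theta>) (\<lambda>z. z ^ n j * V j z) ?A" if "\<theta> > 0" for \<theta>
    proof (rule expands_cong)
      show "expands (sector_at_infinity \<theta>) (\<lambda>z. of_real (1 / r i) * (z ^ Suc (n i) * \<Phi> F (Suc (n i)) z)) ?A"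
        by (intro expands_mult expands_const A that sector_le_at_infinity)
      show "\<forall>\<^sub>F z in sector_at_infinity \<theta>. of_real (1 / r i) * (z ^ Suc (n i) * \<Phi> F (Suc (n i)) z) = z ^ n j * V j z"
        using nz by eventually_elim (simp add: Suc block_size_2[OF False] T_def r_nonzero field_simps)
    qed
    moreover have "fps_nth ?A 0 = 1"
      using block_size_2[OF False] A(1) r_nonzero[of i] by (simp add: r_def h_Suc)
    ultimately show ?thesis by blast
  qed
qed

lemma V_nonzero_sector:
  assumes "\<theta> > 0" shows "eventually (\<lambda>z. V j z \<noteq> 0) (sector_at_infinity \<theta>)"
proof -
  obtain A where "fps_nth A 0 = 1" "expands (sector_at_infinity \<theta>) (\<lambda>z. z ^ n j * V j z) A"
    using expands_V assms by blast
  then have "((\<lambda>z. z ^ n j * V j z) \<longlongrightarrow> 1) (sector_at_infinity \<theta>)"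
    using expands_tendsto[OF sector_le_at_infinity] by force
  then have "eventually (\<lambda>z. z ^ n j * V j z \<noteq> 0) (sector_at_infinity \<theta>)"
    by (rule tendsto_imp_eventually_ne) simp
  then show ?thesis by eventually_elim simp
qed

text \<open>
  The zeros of $V_j$ are isolated, because $V_j$ is holomorphic on a connected set and its
  asymptotic behaviour excludes $V_j = 0$ identically.
\<close>
lemma V_nonzero_cosparse: "\<forall>\<^sub>\<approx>z\<in>upper_hp. V j z \<noteq> 0"
proof -
  have pos: "(0::real) < 1" by simp
  have "eventually (\<lambda>z. V j z \<noteq> 0 \<and> z \<in> upper_hp) (sector_at_infinity 1)"
    using V_nonzero_sector[OF pos, of j] eventually_sector_Im[OF pos] by eventually_elim auto
  then obtain w where w: "w \<in> upper_hp" "V j w \<noteq> 0"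
    using eventually_happens'[OF sector_ne_bot] by blast
  show ?thesis
    unfolding eventually_cosparse_open_eq[OF open_upper_hp]
  proof
    fix z assume "z \<in> upper_hp"
    from non_zero_neighbour_alt[OF holomorphic_V open_upper_hp connected_upper_hp this w]
    show "eventually (\<lambda>z. V j z \<noteq> 0) (at z)"
      by eventually_elim simp
  qed
qed

text \<open>
  As $r_j = -l_jh_{n_j}$ with $h_{n_j} > 0$, this is the sign of $-r_j$.
\<close>
definition \<epsilon> :: "nat \<Rightarrow> real" where "\<epsilon> j = sgn (l j)"

definition \<beta> :: "nat \<Rightarrow> real" where "\<beta> j = sqrt \<bar>r (Suc j) / r j\<bar>"

text \<open>
  The functions of the continued fraction expansion.
\<close>
definition G :: "nat \<Rightarrow> complex \<Rightarrow> complex" where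
  "G j z = - of_real (\<epsilon> j) * V (Suc j) z / V j z"

lemma \<epsilon>_cases: "\<epsilon> j \<in> {1, - 1}" and \<epsilon>_square: "\<epsilon> j * \<epsilon> j = 1"
  using l_nonzero[of j] by (auto simp: \<epsilon>_def sgn_if)

lemma \<epsilon>_\<beta>: "\<epsilon> j * \<epsilon> (Suc j) * (\<beta> j)\<^sup>2 = l (Suc j) * u j"
proof -
  have "r (Suc j) / r j = l (Suc j) / l j * (h (n (Suc j)) / h (n j))"
    by (simp add: r_def)
  then have "sgn (r (Suc j) / r j) = \<epsilon> j * \<epsilon> (Suc j)"
    using h_pos[of "n j"] h_pos[of "n (Suc j)"] by (simp add: \<epsilon>_def sgn_mult sgn_divide)
  then show ?thesis
    unfolding r_ratio[symmetric] \<beta>_def by (metis abs_ge_zero mult.commute mult_sgn_abs real_sqrt_pow2)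
qed

lemma \<beta>_pos: "\<beta> j > 0"
  using r_nonzero by (simp add: \<beta>_def)

lemma n_less: "n j < n (Suc j)"
  by (simp add: n_Suc)

lemma expands_G:
  "\<exists>A. fps_nth A 0 = - \<epsilon> j \<and>
     (\<forall>\<theta>>0. expands (sector_at_infinity \<theta>) (\<lambda>z. z ^ (n (Suc j) - n j) * G j z) A)"
proof -
  obtain A where A: "fps_nth A 0 = 1" "\<And>\<theta>. \<theta> > 0 \<Longrightarrow> expands (sector_at_infinity \<theta>) (\<lambda>z. z ^ n j * V j z) A"
    using expands_V by blast
  obtain B where B: "fps_nth B 0 = 1" "\<And>\<theta>. \<theta> > 0 \<Longrightarrow> expands (sector_at_infinity \<theta>) (\<lambda>z. z ^ n (Suc j) * V (Suc j) z) B"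
    using expands_V by blast
  let ?A = "fps_const (- \<epsilon> j) * (B * inverse A)"
  have "expands (sector_at_infinity \<theta>) (\<lambda>z. z ^ (n (Suc j) - n j) * G j z) ?A" if "\<theta> > 0" for \<theta>
  proof (rule expands_cong)
    show "expands (sector_at_infinity \<theta>) (\<lambda>z. of_real (- \<epsilon> j) *
        ((z ^ n (Suc j) * V (Suc j) z) * (1 / (z ^ n j * V j z)))) ?A"
      by (intro expands_mult expands_const expands_inverse A B that sector_le_at_infinity) (simp add: A)
    have "eventually (\<lambda>z. z \<noteq> 0) (sector_at_infinity \<theta>)"
      using eventually_sector by eventually_elim simp
    then show "\<forall>\<^sub>F z in sector_at_infinity \<theta>. of_real (- \<epsilon> j) *
        ((z ^ n (Suc j) * V (Suc j) z) * (1 / (z ^ n j * V j z))) = z ^ (n (Suc j) - n j) * G j z"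
    proof eventually_elim
      case (elim z)
      have "z ^ n (Suc j) = z ^ (n (Suc j) - n j) * z ^ n j"
        using n_less[of j] by (simp flip: power_add)
      then show ?case using elim by (simp add: G_def del: V.simps)
    qed
  qed
  moreover have "fps_nth ?A 0 = - \<epsilon> j"
    by (simp add: A B)
  ultimately show ?thesis by blast
qed

lemma G_tendsto_0:
  assumes "\<theta> > 0" shows "(G j \<longlongrightarrow> 0) (sector_at_infinity \<theta>)"
proof -
  let ?k = "n (Suc j) - n j"
  obtain A where A: "expands (sector_at_infinity \<theta>) (\<lambda>z. z ^ ?k * G j z) A"
    using expands_G assms by blast
  have "expands (sector_at_infinity \<theta>) (G j) (fps_X ^ ?k * A)"
  proof (rule expands_cong[OF expands_mult[OF sector_le_at_infinity expands_inverse_power[OF sector_le_at_infinity] A]])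
    show "\<forall>\<^sub>F z in sector_at_infinity \<theta>. 1 / z ^ ?k * (z ^ ?k * G j z) = G j z"
      using eventually_sector by eventually_elim simp
  qed
  then have "(G j \<longlongrightarrow> of_real (fps_nth (fps_X ^ ?k * A) 0)) (sector_at_infinity \<theta>)"
    by (rule expands_tendsto[OF sector_le_at_infinity])
  then show ?thesis using n_less[of j] by (simp add: fps_X_power_mult_nth del: fps_mult_nth_0)
qed

text \<open>
  A zero of $V_j$ does no harm: there $G_j = 0$, and $-1/0 = 0$ agrees with the right hand side.
\<close>
lemma G_recurrence:
  assumes "z \<noteq> 0" "V (Suc j) z \<noteq> 0"
  shows "- 1 / G j z = of_real (\<epsilon> j) * cpoly (p j) z + of_real ((\<beta> j)\<^sup>2) * G (Suc j) z"
proof -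
  have eps: "of_real (\<epsilon> j) * of_real (\<epsilon> j) = (1::complex)" for j
    by (simp add: \<epsilon>_square flip: of_real_mult)
  have "- 1 / G j z = of_real (\<epsilon> j) * (V j z / V (Suc j) z)"
  proof (cases "V j z = 0")
    case False
    have "\<epsilon> j \<noteq> 0" using \<epsilon>_cases[of j] by auto
    then show ?thesis using False assms eps[of j] by (simp add: G_def field_simps)
  qed (simp add: G_def)
  also have "V j z = cpoly (p j) z * V (Suc j) z - of_real (r (Suc j) / r j) * V (Suc (Suc j)) z"
    using V_recurrence[OF assms(1), of j] by simp
  also have "of_real (r (Suc j) / r j) = (of_real (\<epsilon> j) * of_real (\<epsilon> (Suc j)) * of_real ((\<beta> j)\<^sup>2) :: complex)"
    by (simp add: r_ratio flip: \<epsilon>_\<beta>)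
  also have "of_real (\<epsilon> j) * ((cpoly (p j) z * V (Suc j) z
        - of_real (\<epsilon> j) * of_real (\<epsilon> (Suc j)) * of_real ((\<beta> j)\<^sup>2) * V (Suc (Suc j)) z) / V (Suc j) z)
      = of_real (\<epsilon> j) * cpoly (p j) z
        - (of_real (\<epsilon> j) * of_real (\<epsilon> j)) * of_real (\<epsilon> (Suc j)) * of_real ((\<beta> j)\<^sup>2) * (V (Suc (Suc j)) z / V (Suc j) z)"
    using assms(2) by (simp add: field_simps)
  also have "\<dots> = of_real (\<epsilon> j) * cpoly (p j) z + of_real ((\<beta> j)\<^sup>2) * G (Suc j) z"
    unfolding eps by (simp add: G_def)
  finally show ?thesis .
qed

lemma degree_p: "Polynomial.degree (p j) = n (Suc j) - n j" and monic_p: "lead_coeff (p j) = 1"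
  by (simp_all add: p_def Let_def n_Suc)

lemma continued_fraction_data_G:
  "continued_fraction_data (G 0) (block_size n) \<epsilon> p \<beta>"
  unfolding continued_fraction_data_def
proof (intro exI[of _ G] conjI allI)
  fix j
  have "V i meromorphic_on upper_hp" for i
    using holomorphic_V open_upper_hp by (intro analytic_on_imp_meromorphic_on) (simp only: analytic_on_open)
  then show "G j meromorphic_on upper_hp"
    unfolding G_def[abs_def] by (intro meromorphic_intros)
  show "\<exists>s. nt_expansion (G j) s \<and> \<epsilon> j = first_nonzero s"
  proof -
    obtain A where A: "fps_nth A 0 = - \<epsilon> j"
      "\<And>\<theta>. \<theta> > 0 \<Longrightarrow> expands (sector_at_infinity \<theta>) (\<lambda>z. z ^ (n (Suc j) - n j) * G j z) A"
      using expands_G by blast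
    have "\<exists>s. nt_expansion (G j) s \<and> first_nonzero s = - fps_nth A 0"
      by (rule nt_expansion_leading[OF A(2)]) (use n_less[of j] A(1) \<epsilon>_cases[of j] in auto)
    then show ?thesis using A(1) by auto
  qed
  show "\<epsilon> j \<in> {1, - 1}" by (rule \<epsilon>_cases)
  show "Polynomial.degree (p j) = block_size n j" by (simp add: degree_p block_size_def)
  show "lead_coeff (p j) = 1" by (rule monic_p)
  show "\<beta> j > 0" by (rule \<beta>_pos)
  show "\<forall>\<^sub>\<approx>z\<in>upper_hp. - 1 / G j z = of_real (\<epsilon> j) * cpoly (p j) z + of_real ((\<beta> j)\<^sup>2) * G (Suc j) z"
    using V_nonzero_cosparse[of "Suc j"] eventually_in_cosparse[OF order.refl open_upper_hp]
    by eventually_elim (simp only: G_recurrence upper_hp_nonzero not_False_eq_True)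
  fix \<theta> :: real
  show "0 < \<theta> \<longrightarrow> (\<lambda>z. - 1 / G j z - of_real (\<epsilon> j) * cpoly (p j) z) \<in> o[sector_at_infinity \<theta>](\<lambda>_. 1)"
  proof
    assume \<theta>: "0 < \<theta>"
    have "((\<lambda>z. of_real ((\<beta> j)\<^sup>2) * G (Suc j) z) \<longlongrightarrow> of_real ((\<beta> j)\<^sup>2) * 0) (sector_at_infinity \<theta>)"
      by (intro tendsto_mult tendsto_const G_tendsto_0 \<theta>)
    moreover have "\<forall>\<^sub>F z in sector_at_infinity \<theta>. of_real ((\<beta> j)\<^sup>2) * G (Suc j) z = - 1 / G j z - of_real (\<epsilon> j) * cpoly (p j) z"
      using V_nonzero_sector[OF \<theta>, of "Suc j"] eventually_sector
    proof eventually_elim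
      case (elim z)
      then show ?case using G_recurrence[of z j] by (simp del: V.simps)
    qed
    ultimately have "((\<lambda>z. - 1 / G j z - of_real (\<epsilon> j) * cpoly (p j) z) \<longlongrightarrow> 0) (sector_at_infinity \<theta>)"
      using Lim_transform_eventually by fastforce
    then show "(\<lambda>z. - 1 / G j z - of_real (\<epsilon> j) * cpoly (p j) z) \<in> o[sector_at_infinity \<theta>](\<lambda>_. 1)"
      by (intro smalloI_tendsto) simp_all
  qed
qed simp

lemma first_nonzero_eq: "first_nonzero (case_nat s (moment \<sigma>)) = l 0"
proof (cases "s = 0")
  case True
  have X: "X (Suc 0) = 0" using X_1 True by (rule trans)
  then have "l 0 = moment \<sigma> 0"
    using X_recurrence[of 0] by (simp add: l_def n_Suc n_0 X_0 C_def)
  moreover have "(LEAST j. case_nat s (moment \<sigma>) j \<noteq> 0) = 1"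
    by (rule Least_equality) (use True \<mu>_pos in \<open>auto simp: Suc_le_eq split: nat.splits\<close>)
  ultimately show ?thesis by (simp add: first_nonzero_def)
next
  case False
  have "(LEAST j. case_nat s (moment \<sigma>) j \<noteq> 0) = 0"
    by (rule Least_equality) (use False in auto)
  then show ?thesis
    using False by (simp add: first_nonzero_def l_def n_Suc n_0 X_0 X_1)
qed

lemma G_0: "G 0 = (\<lambda>z. (F z / z - of_real s / z) / of_real \<bar>first_nonzero (case_nat s (moment \<sigma>))\<bar>)"
proof
  fix z
  have "a 0 = s" by (simp add: a_def n_0 X_0 X_1)
  moreover have "r 0 = - l 0" by (simp add: r_def n_0 h_def)
  moreover have "of_real (sgn (l 0)) = (of_real (l 0) / of_real \<bar>l 0\<bar> :: complex)"
    by (simp only: real_sgn_eq of_real_divide)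
  ultimately show "G 0 z = (F z / z - of_real s / z) / of_real \<bar>first_nonzero (case_nat s (moment \<sigma>))\<bar>"
    using l_nonzero[of 0]
    by (cases "z = 0") (simp_all add: G_def \<epsilon>_def T_def n_0 first_nonzero_eq field_simps)
qed

lemma expands_F:
  assumes "\<theta> > 0"
  shows "expands (sector_at_infinity \<theta>) F (Abs_fps (\<lambda>i. case i of 0 \<Rightarrow> 0 | Suc j \<Rightarrow> - moment \<sigma> j))"
proof (rule expands_cong)
  have *: "moment_functional (moment \<sigma>) (Polynomial.monom 1 j * 1) = moment \<sigma> j" for j
    by (subst moment_functional_monom_mult) (simp add: moment_functional_def)
  show "expands (sector_at_infinity \<theta>) (cauchy_transform \<sigma> 1) (Abs_fps (\<lambda>i. case i of 0 \<Rightarrow> 0 | Suc j \<Rightarrow> - moment \<sigma> j))"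
    using expands_cauchy_transform[OF represents assms, of 1] unfolding * .
  show "\<forall>\<^sub>F z in sector_at_infinity \<theta>. cauchy_transform \<sigma> 1 z = F z"
    using eventually_sector_Im[OF assms] by eventually_elim (simp add: cauchy_transform_1[OF represents])
qed

lemma nt_expansion_F: "nt_expansion F (moment \<sigma>)"
  using nt_expansion_of_expands[OF expands_F] by simp

lemma nt_expansion_transform:
  "nt_expansion (\<lambda>z. F z / z - of_real s / z) (case_nat s (moment \<sigma>))"
proof -
  let ?A = "Abs_fps (\<lambda>i. case i of 0 \<Rightarrow> 0 | Suc j \<Rightarrow> - moment \<sigma> j)"
  let ?B = "fps_X ^ 1 * (?A - fps_const s)"
  have "expands (sector_at_infinity \<theta>) (\<lambda>z. F z / z - of_real s / z) ?B" if "\<theta> > 0" for \<theta>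
  proof (rule expands_cong)
    show "expands (sector_at_infinity \<theta>) (\<lambda>z. 1 / z ^ 1 * (F z - of_real s)) ?B"
      by (intro expands_mult expands_inverse_power expands_diff expands_F expands_const that sector_le_at_infinity)
  qed (simp add: diff_divide_distrib)
  then have "nt_expansion (\<lambda>z. F z / z - of_real s / z) (\<lambda>j. - fps_nth ?B (Suc j))"
    by (rule nt_expansion_of_expands) simp_all
  also have "(\<lambda>j. - fps_nth ?B (Suc j)) = case_nat s (moment \<sigma>)"
    by (auto simp: fun_eq_iff split: nat.splits)
  finally show ?thesis .
qed

lemma P_hat_eq_X:
  assumes "1 \<le> m"
  shows "P_hat \<sigma> P s (m - 1) 0 = X m"
proof -
  obtain d q where Pq: "P (m - 1) = pCons d q" by (rule pCons_cases)
  then show ?thesis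
    using assms second_kind_eq[where P = P and j = "m - 1", OF represents Pq]
    by (cases m) (simp_all add: P_hat_def X_def moment_functional_pCons mult.commute)
qed

end

section \<open>Identification of the generalized Jacobi matrix\<close>

lemma D_plus_transform:
  assumes F: "F \<in> Nevanlinna" and exp_F: "nt_expansion F \<mu>"
    and exp_G: "nt_expansion (\<lambda>z. F z / z - of_real s / z) (case_nat s \<mu>)"
  shows "(\<lambda>z. F z / z - of_real s / z) \<in> D_plus"
proof -
  let ?G = "\<lambda>z. F z / z - of_real s / z"
  have eq: "z * ?G z + of_real s = F z" if "z \<noteq> 0" for z
    using that by (simp add: field_simps)
  have hol: "F holomorphic_on upper_hp" using F by (simp add: Nevanlinna_def)
  have "?G holomorphic_on upper_hp"
    by (intro holomorphic_intros hol) (simp_all add: upper_hp_nonzero)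
  then have "?G meromorphic_on upper_hp"
    by (intro analytic_on_imp_meromorphic_on) (simp add: analytic_on_open open_upper_hp)
  moreover have "(\<lambda>z. z * ?G z + of_real s) \<in> N_minus_infinity"
  proof -
    have "(\<lambda>z. z * ?G z + of_real s) holomorphic_on upper_hp"
      using hol holomorphic_cong[OF refl, of upper_hp "\<lambda>z. z * ?G z + of_real s" F] eq upper_hp_nonzero by metis
    moreover have "z * ?G z + of_real s \<in> upper_hp" if "z \<in> upper_hp" for z
      using F that eq[OF upper_hp_nonzero[OF that]] by (auto simp: Nevanlinna_def)
    moreover have "nt_expansion (\<lambda>z. z * ?G z + of_real s) \<mu>"
      unfolding nt_expansion_def
    proof (intro allI impI)
      fix m and \<theta> :: real assume "\<theta> > 0"
      have "\<forall>\<^sub>F z in sector_at_infinity \<theta>. F z - - (\<Sum>j\<le>2 * m. of_real (\<mu> j) / z ^ (j + 1)) =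
          z * ?G z + of_real s - - (\<Sum>j\<le>2 * m. of_real (\<mu> j) / z ^ (j + 1))"
        using eventually_sector by eventually_elim (simp only: eq not_False_eq_True)
      from landau_o.small.in_cong[OF this]
      show "(\<lambda>z. z * ?G z + of_real s - - (\<Sum>j\<le>2 * m. of_real (\<mu> j) / z ^ (j + 1)))
          \<in> o[sector_at_infinity \<theta>](\<lambda>z. 1 / z ^ (2 * m + 1))"
        using exp_F \<open>\<theta> > 0\<close> by (auto simp: nt_expansion_def)
    qed
    ultimately show ?thesis by (auto simp: N_minus_infinity_def Nevanlinna_def)
  qed
  ultimately show ?thesis
    using exp_G by (auto simp: D_plus_def intro!: exI[of _ "case_nat s \<mu>"])
qed

lemma not_rational_transform:
  assumes "\<not> rational_on_upper_hp F"
  shows "\<not> rational_on_upper_hp (\<lambda>z. F z / z - of_real s / z)"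
proof
  assume "rational_on_upper_hp (\<lambda>z. F z / z - of_real s / z)"
  then obtain p q :: "complex poly" where pq: "q \<noteq> 0"
    "\<forall>\<^sub>\<approx>z\<in>upper_hp. F z / z - of_real s / z = poly p z / poly q z"
    by (auto simp: rational_on_upper_hp_def)
  have "\<forall>\<^sub>\<approx>z\<in>upper_hp. poly q z \<noteq> 0"
    unfolding eventually_cosparse
    by (rule finite_imp_sparse) (simp add: poly_roots_finite pq(1))
  with pq(2) eventually_in_cosparse[OF order.refl open_upper_hp]
  have "\<forall>\<^sub>\<approx>z\<in>upper_hp. F z = poly (pCons 0 p + Polynomial.smult (of_real s) q) z / poly q z"
  proof eventually_elim
    case (elim z)
    have "F z = z * (F z / z - of_real s / z) + of_real s"
      using upper_hp_nonzero[OF elim(2)] by (simp add: field_simps)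
    then show ?case unfolding elim(1) using elim(3) by (simp add: field_simps)
  qed
  then have "rational_on_upper_hp F"
    unfolding rational_on_upper_hp_def using pq(1) by blast
  then show False using assms by simp
qed

text \<open>
  If the measure vanished, so would \<open>F\<close>, which maps into the open half plane.
\<close>
lemma moment_0_pos:
  assumes "F \<in> Nevanlinna" and "represents \<sigma> F"
  shows "moment \<sigma> 0 > 0"
proof (rule ccontr)
  assume "\<not> moment \<sigma> 0 > 0"
  interpret finite_measure \<sigma> using assms(2) by (simp add: represents_def)
  have "measure \<sigma> (space \<sigma>) = 0"
    using \<open>\<not> moment \<sigma> 0 > 0\<close> measure_nonneg[of \<sigma> "space \<sigma>"] by (simp add: moment_def)
  then have "emeasure \<sigma> (space \<sigma>) = 0" by (simp add: emeasure_eq_measure)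
  then have "AE t in \<sigma>. False" by (intro AE_I[of _ _ "space \<sigma>"]) auto
  then have "AE t in \<sigma>. 1 / (complex_of_real t - \<i>) = 0" by eventually_elim simp
  then have "(\<integral>t. 1 / (complex_of_real t - \<i>) \<partial>\<sigma>) = 0"
    by (rule integral_eq_zero_AE)
  moreover have "\<i> \<in> upper_hp" by (simp add: upper_hp_def)
  ultimately have "F \<i> = 0" "F \<i> \<in> upper_hp"
    using assms by (auto simp: represents_def Nevanlinna_def)
  then show False by (simp add: upper_hp_def)
qed

theorem theorem4p5:
  fixes F :: "complex \<Rightarrow> complex" and \<sigma> :: "real measure" and P :: "nat \<Rightarrow> real poly"
    and s\<^sub>m\<^sub>1 :: real and J U L :: inf_mat
  assumes "F \<in> N_minus_infinity" and "\<not> rational_on_upper_hp F"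
    and "monic_jacobi_of F \<sigma> P J"
    and "block_UL_factorization \<sigma> P s\<^sub>m\<^sub>1 J U L"
  shows "(\<lambda>z. F z / z - of_real s\<^sub>m\<^sub>1 / z) \<in> D_plus \<and>
         monic_generalized_jacobi_of (\<lambda>z. F z / z - of_real s\<^sub>m\<^sub>1 / z) (L \<odot> U)"
proof -
  have F: "F \<in> Nevanlinna" using assms(1) by (simp add: N_minus_infinity_def)
  from assms(3) obtain b c where rep: "represents \<sigma> F" and orth: "monic_orthogonal \<sigma> P"
    and c: "\<And>j. c j > 0" and rec: "three_term_recurrence P b c" and J: "J = monic_jacobi b c"
    by (auto simp: monic_jacobi_of_def)
  have P_0: "P 0 = 1"
  proof -
    have "Polynomial.degree (P 0) = 0" "lead_coeff (P 0) = 1"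
      using orth unfolding monic_orthogonal_def by blast+
    then show ?thesis by (metis degree_eq_zeroE lead_coeff_pCons(2) one_pCons)
  qed
  interpret jacobi_function \<sigma> P b c s\<^sub>m\<^sub>1 F
  proof
    fix j
    show "Polynomial.degree (P j) = j" "lead_coeff (P j) = 1"
      using orth unfolding monic_orthogonal_def by blast+
    have "(\<integral>t. poly (P 0) t * poly (P (Suc j)) t \<partial>\<sigma>) = 0"
      using orth by (simp add: monic_orthogonal_def)
    then show "moment_functional (moment \<sigma>) (P (Suc j)) = 0"
      by (simp add: P_0 integral_poly[OF rep])
  qed (use P_0 rec c rep moment_0_pos[OF F rep] F in \<open>auto simp: Nevanlinna_def\<close>)
  interpret blocks: small_blocks n
    by standard (simp_all add: n_0 n_Suc)
  from assms(4) obtain u' e l' where U: "U = U_factor n u'" and L: "L = L_factor n e l'"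
    and l': "l' = (\<lambda>j. - P_hat \<sigma> P s\<^sub>m\<^sub>1 (n (Suc j) - 1) 0 / P_hat \<sigma> P s\<^sub>m\<^sub>1 (n j - 1) 0)"
    and UL: "J = U \<odot> L"
    unfolding block_UL_factorization_def Let_def n_def by blast
  have n_pos: "1 \<le> n (Suc j)" for j
    using n_less[of j] by simp
  have l'_eq: "l' (Suc j) = l (Suc j)" for j
    by (simp only: l' P_hat_eq_X[OF n_pos] l_def)
  have size: "block_size n j = 1 \<longleftrightarrow> n (Suc j) = Suc (n j)" for j
    using n_less[of j] by (auto simp: block_size_def)
  have u'_eq: "u' j = u j" for j
  proof (cases "n (Suc j) = Suc (n j)")
    case True
    have "J (n j) (n j) = u' j + (if block_size n (Suc j) = 1 then l' (Suc j) else 0)"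
      unfolding UL U L by (rule blocks.UL_block_size_1) (simp only: size True)
    also have "\<dots> = u' j + a (Suc j)"
      unfolding size a_eq l'_eq ..
    finally have "b (n j) = u' j + a (Suc j)"
      by (simp add: J monic_jacobi_def)
    then show ?thesis using True by (simp add: u_def)
  next
    case False
    then have "block_size n j = 2"
      using blocks.block_size_cases[of j] size[of j] by blast
    then have "J (Suc (n j)) (n j) = u' j"
      unfolding UL U L by (rule blocks.UL_block_size_2)
    then show ?thesis using False by (simp add: J monic_jacobi_def u_def)
  qed
  have e_eq: "e j = b (n j)" if "block_size n j = 2" for j
  proof -
    have "J (n j) (n j) = e j"
      unfolding UL U L by (rule blocks.UL_block_size_2) (rule that)
    then show ?thesis by (simp add: J monic_jacobi_def)
  qed
  have LU: "L \<odot> U = generalized_jacobi n p (\<lambda>j. \<epsilon> j * \<epsilon> (Suc j) * (\<beta> j)\<^sup>2)"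
    unfolding U L
  proof (rule blocks.LU_eq_generalized_jacobi)
    show "Polynomial.coeff (p j) 0 = - (u' j + (if j = 0 then 0 else l' j))" for j
      by (cases j) (simp_all add: p_def Let_def u'_eq l'_eq)
    show "Polynomial.coeff (p j) 1 = - e j" if "block_size n j = 2" for j
      using that size[of j] by (simp add: p_def Let_def e_eq)
    show "\<epsilon> j * \<epsilon> (Suc j) * (\<beta> j)\<^sup>2 = l' (Suc j) * u' j" for j
      by (simp add: \<epsilon>_\<beta> l'_eq u'_eq)
  qed
  have D: "(\<lambda>z. F z / z - of_real s\<^sub>m\<^sub>1 / z) \<in> D_plus"
    by (rule D_plus_transform[OF F nt_expansion_F nt_expansion_transform])
  moreover have "monic_generalized_jacobi_of (\<lambda>z. F z / z - of_real s\<^sub>m\<^sub>1 / z) (L \<odot> U)"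
    unfolding monic_generalized_jacobi_of_def
  proof (intro conjI exI)
    show "(\<lambda>z. F z / z - of_real s\<^sub>m\<^sub>1 / z) \<in> D_plus \<union> D_minus" using D by simp
    show "\<not> rational_on_upper_hp (\<lambda>z. F z / z - of_real s\<^sub>m\<^sub>1 / z)"
      by (rule not_rational_transform[OF assms(2)])
    show "nt_expansion (\<lambda>z. F z / z - of_real s\<^sub>m\<^sub>1 / z) (case_nat s\<^sub>m\<^sub>1 (moment \<sigma>))"
      by (rule nt_expansion_transform)
    show "continued_fraction_data (\<lambda>z. (F z / z - of_real s\<^sub>m\<^sub>1 / z)
        / of_real \<bar>first_nonzero (case_nat s\<^sub>m\<^sub>1 (moment \<sigma>))\<bar>)
        (block_size (normal_index (case_nat s\<^sub>m\<^sub>1 (moment \<sigma>)))) \<epsilon> p \<beta>"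
      using continued_fraction_data_G unfolding G_0 n_def .
    show "L \<odot> U = generalized_jacobi (normal_index (case_nat s\<^sub>m\<^sub>1 (moment \<sigma>))) p
        (\<lambda>j. \<epsilon> j * \<epsilon> (Suc j) * (\<beta> j)\<^sup>2)"
      using LU unfolding n_def .
  qed
  ultimately show ?thesis ..
qed

end
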